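(* Let $d=2$. There exist a universal constant $c>0$ and, for dyadic $L\ge1$ and $\mu$ a Poisson point process on $Q_L$, a family of random variables $r_{*,L}=r_{*,L}(\mu)\ge1$ satisfying $$\sup_L\ \mathbb E_L\left[\exp\left(\frac{c\,r_{*,L}^2}{\log(2r_{*,L})}\right)\right]<\infty$$ and such that for every dyadic $\ell$ with $2r_{*,L}\le\ell\le L$, $$\frac1{\ell^4}W_2^2\left(\mu_\ell,\frac{\mu(Q_\ell)}{\ell^2}\chi_{Q_\ell}\right)\le\frac{\log\left(\frac{\ell}{r_{*,L}}\right)}{\left(\frac{\ell}{r_{*,L}}\right)^2}.$$
   Context: $Q_\ell=[-\frac\ell2,\frac\ell2)^2\subset\mathbb R^2$; dyadic means of the form $2^k$, $k\in\mathbb N$; $\log$ is the natural logarithm. $\mu$ is the Poisson point process on $Q_L$ with intensity the Lebesgue measure, $\mathbb E_L$ denotes expectation with respect to its law, and $\mu_\ell=\mu\llcorner Q_\ell$ is the restriction of $\mu$ to $Q_\ell$. $W_2^2(\lambda,\nu)=\min_\Pi\int|x-y|^2d\Pi$ over couplings $\Pi$ of the finite measures $\lambda,\nu$ of equal mass on $\mathbb R^2$ (Euclidean Wasserstein distance). *)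

theory Defs
  imports "HOL-Probability.Probability"
begin

text \<open>The norm of \<^typ>\<open>real \<times> real\<close> is the Euclidean one and its \<^const>\<open>lborel\<close> is
  two-dimensional Lebesgue measure.\<close>

type_synonym plane = "real \<times> real"

definition Q :: "real \<Rightarrow> plane set" where
  "Q l = {-l/2..<l/2} \<times> {-l/2..<l/2}"

definition dyadic :: "real set" where
  "dyadic = {2 ^ k | k :: nat. True}"

text \<open>A configuration of finitely many points of \<open>S\<close>, counted with multiplicity, is encoded as a
  finite integer-valued Borel measure on the whole plane that does not charge the complement
  of \<open>S\<close>.\<close>

definition configurations :: "plane set \<Rightarrow> plane measure set" where
  "configurations S = {\<mu>. sets \<mu> = sets borel \<and> emeasure \<mu> (- S) = 0 \<and>
     (\<forall>A \<in> sets borel. \<exists>n :: nat. emeasure \<mu> A = of_nat n)}"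

definition configuration_algebra :: "plane set \<Rightarrow> plane measure measure" where
  "configuration_algebra S = sigma (configurations S)
     {(\<lambda>\<mu>. emeasure \<mu> A) -` B \<inter> configurations S | A B. A \<in> sets borel \<and> B \<in> sets borel}"

text \<open>\<open>P\<close> is the law, on the space of configurations, of the Poisson point process on \<open>S\<close> whose
  intensity is Lebesgue measure. It is meant for Borel \<open>S\<close> of finite Lebesgue measure. For
  Lebesgue-null \<open>A\<close> the Poisson weights are those of the point mass at \<open>0\<close>, since \<open>0 ^ 0 = 1\<close>.\<close>

definition poisson_process_law :: "plane set \<Rightarrow> plane measure measure \<Rightarrow> bool" where
  "poisson_process_law S P \<longleftrightarrow>
     prob_space P \<and>
     sets P = sets (configuration_algebra S) \<and>
     (\<forall>A \<in> sets borel. A \<subseteq> S \<longrightarrow>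
        (\<forall>k :: nat. measure P {\<mu> \<in> space P. emeasure \<mu> A = of_nat k}
           = exp (- measure lborel A) * measure lborel A ^ k / fact k)) \<and>
     (\<forall>(n :: nat) A. (\<forall>i < n. A i \<in> sets borel \<and> A i \<subseteq> S) \<and> disjoint_family_on A {..<n} \<longrightarrow>
        prob_space.indep_vars P (\<lambda>_. borel) (\<lambda>i \<mu>. emeasure \<mu> (A i)) {..<n})"

definition couplings :: "plane measure \<Rightarrow> plane measure \<Rightarrow> (plane \<times> plane) measure set" where
  "couplings M N = {\<gamma>. sets \<gamma> = sets borel \<and> distr \<gamma> borel fst = M \<and> distr \<gamma> borel snd = N}"

text \<open>The squared Wasserstein distance. It takes values in \<^typ>\<open>ennreal\<close>, so that the infimum
  is \<open>\<infinity>\<close> when there is no coupling.\<close>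

definition W2_sq :: "plane measure \<Rightarrow> plane measure \<Rightarrow> ennreal" where
  "W2_sq M N = (INF \<gamma> \<in> couplings M N. \<integral>\<^sup>+ (x, y). ennreal ((norm (x - y))\<^sup>2) \<partial>\<gamma>)"

text \<open>The restriction \<open>\<mu> \<llcorner> A\<close> stays a measure on the whole plane, unlike \<^const>\<open>restrict_space\<close>.\<close>

definition restr :: "plane measure \<Rightarrow> plane set \<Rightarrow> plane measure" where
  "restr \<mu> A = density \<mu> (indicator A)"

definition uniform_on :: "real \<Rightarrow> plane set \<Rightarrow> plane measure" where
  "uniform_on a A = density lborel (\<lambda>x. ennreal a * indicator A x)"

end

theory Submission
  imports Defs
begin

text \<open>The square of side \<open>2 ^ k\<close> is bisected \<open>2 k\<close> times, in alternating directions, down to unit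
  cells. A second copy of the square is bisected in parallel, each time in proportion to the numbers
  of points in the two halves (the scheme of Ajtai, Komlos and Tusnady). Each cell then
  corresponds to a rectangle of area proportional to its number of points, and sending the points of
  a cell to its rectangle is a transport plan.

  At each bisection the cost changes by a term that is linear in the imbalance of the two numbers of
  points, hence has mean zero, and by a term that is quadratic in it. The exponential moment of the
  linear term multiplies the current cost by \<open>1 + O(4 ^ (- i))\<close> at the \<open>i\<close>-th scale, and these
  factors have a bounded product. The quadratic terms are weighted by (side of the rectangle in the
  source) times (side of the rectangle in the target), whose sum over all rectangles of a scale does
  not change from one scale to the next, so every scale contributes \<open>O(4 ^ k)\<close>. Hence
  \<open>W\<^sub>2\<^sup>2 / 4 ^ k\<close> has an exponential moment of order \<open>exp O(k)\<close>, which makes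
  the maximum \<open>M\<close> over \<open>k\<close> of \<open>W\<^sub>2\<^sup>2 / (4 ^ k k)\<close> exponentially integrable. The random
  radius is the solution \<open>r\<close> of \<open>r\<^sup>2 / ln (2 r) = M / (ln 2)\<^sup>2\<close>.\<close>

section \<open>Exponential moments of binomial imbalances\<close>

text \<open>For y >= 0 the function y^2/2 - ln (cosh y) vanishes at 0 and has derivative y - tanh y
  >= 0; negative arguments follow by evenness.\<close>

lemma cosh_le_exp_half_square: "cosh x \<le> exp (x\<^sup>2 / 2)" for x :: real
proof -
  have sinh_le: "sinh y \<le> y * cosh y" if "0 \<le> y" for y :: real
  proof -
    have "(\<lambda>y. y * cosh y - sinh y) 0 \<le> (\<lambda>y. y * cosh y - sinh y) y"
      by (rule DERIV_nonneg_imp_nondecreasing[OF that])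
         (auto intro!: derivative_eq_intros exI simp: algebra_simps)
    then show ?thesis by simp
  qed
  have nonneg: "cosh y \<le> exp (y\<^sup>2 / 2)" if "0 \<le> y" for y :: real
  proof -
    have "(\<lambda>y. y\<^sup>2 / 2 - ln (cosh y)) 0 \<le> (\<lambda>y. y\<^sup>2 / 2 - ln (cosh y)) y"
    proof (rule DERIV_nonneg_imp_nondecreasing[OF that])
      fix u :: real assume "0 \<le> u" "u \<le> y"
      then show "\<exists>z. ((\<lambda>y. y\<^sup>2 / 2 - ln (cosh y)) has_real_derivative z) (at u) \<and> 0 \<le> z"
        using sinh_le[of u]
        by (intro exI[of _ "u - sinh u / cosh u"] conjI)
           (auto intro!: derivative_eq_intros simp: cosh_real_pos divide_simps)
    qed
    then have "ln (cosh y) \<le> y\<^sup>2 / 2" by simp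
    then have "exp (ln (cosh y)) \<le> exp (y\<^sup>2 / 2)" by (simp only: exp_le_cancel_iff)
    then show ?thesis by (simp only: exp_ln[OF cosh_real_pos])
  qed
  show ?thesis
    using nonneg[of x] nonneg[of "- x"] by (cases "0 \<le> x") auto
qed

text \<open>Pascal's rule: the last of N + 1 random signs is averaged out.\<close>

lemma sum_binomial_Suc:
  fixes G :: "real \<Rightarrow> real"
  shows "(\<Sum>j\<le>Suc N. real (Suc N choose j) * G (2 * real j - real (Suc N)))
    = (\<Sum>j\<le>N. real (N choose j) * (G (2 * real j - real N + 1) + G (2 * real j - real N - 1)))"
proof -
  have "(\<Sum>j\<le>Suc N. real (Suc N choose j) * G (2 * real j - real (Suc N)))
      = G (- real (Suc N)) + (\<Sum>j\<le>N. real (Suc N choose Suc j) * G (2 * real j - real N + 1))"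
    by (subst sum.atMost_Suc_shift) (simp add: algebra_simps)
  also have "\<dots> = (G (- real (Suc N)) + (\<Sum>j\<le>N. real (N choose Suc j) * G (2 * real j - real N + 1)))
      + (\<Sum>j\<le>N. real (N choose j) * G (2 * real j - real N + 1))"
    by (simp add: algebra_simps sum.distrib)
  also have "G (- real (Suc N)) + (\<Sum>j\<le>N. real (N choose Suc j) * G (2 * real j - real N + 1))
      = (\<Sum>j\<le>Suc N. real (N choose j) * G (2 * real j - real N - 1))"
    by (subst sum.atMost_Suc_shift) (simp add: algebra_simps minus_diff_commute)
  also have "\<dots> = (\<Sum>j\<le>N. real (N choose j) * G (2 * real j - real N - 1))"
    by simp
  finally show ?thesis by (simp add: algebra_simps sum.distrib)
qed

text \<open>After division by \<open>2 ^ N\<close>, the right side is the exact value of E exp(b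
  g^2) for a centred Gaussian g of variance N. The induction averages out one sign at a time, each
  sign being dominated by a Gaussian through the bound on cosh.\<close>

lemma sum_binomial_exp_square:
  assumes "0 \<le> b" "2 * b * real N < 1"
  shows "(\<Sum>j\<le>N. real (N choose j) * exp (b * (2 * real j - real N)\<^sup>2)) \<le> 2 ^ N / sqrt (1 - 2 * b * real N)"
  using assms
proof (induction N arbitrary: b)
  case (Suc N)
  \<comment> \<open>Averaging out one sign produces \<open>cosh (2 * b * u)\<close>, which is at
    most exp(2 b^2 u^2); hence b grows by 2 b^2.\<close>
  define b' where "b' = b + 2 * b\<^sup>2"
  have b: "0 \<le> b" "2 * b * real N + 2 * b < 1" using Suc.prems by (auto simp: algebra_simps)
  have bN: "b * (2 * b * real N) \<le> b * 1"
    using b by (intro mult_left_mono) auto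
  have lt: "2 * b' * real N < 1"
    using b bN by (auto simp: b'_def algebra_simps power2_eq_square)
  have step: "exp (b * (u + 1)\<^sup>2) + exp (b * (u - 1)\<^sup>2) \<le> 2 * exp b * exp (b' * u\<^sup>2)" for u :: real
  proof -
    have "exp (b * (u + 1)\<^sup>2) + exp (b * (u - 1)\<^sup>2) = 2 * exp (b + b * u\<^sup>2) * cosh (2 * b * u)"
    proof -
      have "b * (u + 1)\<^sup>2 = (b + b * u\<^sup>2) + 2 * b * u" "b * (u - 1)\<^sup>2 = (b + b * u\<^sup>2) + - (2 * b * u)"
        by (auto simp: algebra_simps power2_eq_square)
      then show ?thesis
        unfolding cosh_field_def exp_add by (simp only: exp_add) (simp add: algebra_simps)
    qed
    also have "\<dots> \<le> 2 * exp (b + b * u\<^sup>2) * exp ((2 * b * u)\<^sup>2 / 2)"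
      by (intro mult_left_mono cosh_le_exp_half_square) auto
    also have "\<dots> = 2 * exp b * exp (b' * u\<^sup>2)"
      by (simp add: exp_add[symmetric] b'_def) (simp add: algebra_simps power2_eq_square)
    finally show ?thesis .
  qed
  have "(\<Sum>j\<le>Suc N. real (Suc N choose j) * exp (b * (2 * real j - real (Suc N))\<^sup>2))
      = (\<Sum>j\<le>N. real (N choose j) * (exp (b * (2 * real j - real N + 1)\<^sup>2) + exp (b * (2 * real j - real N - 1)\<^sup>2)))"
    by (rule sum_binomial_Suc)
  also have "\<dots> \<le> (\<Sum>j\<le>N. real (N choose j) * (2 * exp b * exp (b' * (2 * real j - real N)\<^sup>2)))"
    by (intro sum_mono mult_left_mono step) auto
  also have "\<dots> = 2 * exp b * (\<Sum>j\<le>N. real (N choose j) * exp (b' * (2 * real j - real N)\<^sup>2))"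
    by (simp add: sum_distrib_left algebra_simps)
  also have "\<dots> \<le> 2 * exp b * (2 ^ N / sqrt (1 - 2 * b' * real N))"
    using lt b by (intro mult_left_mono Suc.IH) (auto simp: b'_def)
  also have "\<dots> \<le> 2 ^ Suc N / sqrt (1 - 2 * b * real (Suc N))"
  proof -
    \<comment> \<open>After squaring, the claim is exp z (1 - y - z) <= 1 - y - z y. It combines exp
      z (1 - z) <= 1 with y (1 + z) <= y exp z.\<close>
    define z y where "z = 2 * b" and "y = z * real N"
    have zy: "0 \<le> z" "0 \<le> y" "y + z < 1" using b by (auto simp: z_def y_def)
    have e: "1 + z \<le> exp z" by (rule exp_ge_add_one_self)
    have "exp z * (1 - z) \<le> exp z * exp (- z)"
      using exp_ge_add_one_self[of "-z"] by (intro mult_left_mono) auto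
    then have e1: "exp z * (1 - z) \<le> 1" by (simp add: exp_minus)
    have e2: "y * (1 + z) \<le> y * exp z" using e zy by (intro mult_left_mono) auto
    have le: "exp z * (1 - y - z) \<le> 1 - y - z * y" using e1 e2 by (simp add: algebra_simps)
    have eqs: "1 - 2 * b * real (Suc N) = 1 - y - z" "1 - 2 * b' * real N = 1 - y - z * y"
      by (auto simp: z_def y_def b'_def algebra_simps power2_eq_square)
    have "sqrt (exp z * (1 - y - z)) \<le> sqrt (1 - y - z * y)"
      using le by simp
    moreover have "sqrt (exp z) = exp b"
      by (rule real_sqrt_unique) (auto simp: z_def power2_eq_square exp_add[symmetric])
    ultimately have "exp b * sqrt (1 - y - z) \<le> sqrt (1 - y - z * y)"
      by (simp add: real_sqrt_mult)
    moreover have "0 < sqrt (1 - y - z)" "0 < sqrt (1 - y - z * y)"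
      using zy lt eqs(2) by auto
    ultimately show ?thesis unfolding eqs by (simp add: divide_simps)
  qed
  finally show ?case .
qed simp

text \<open>Here \<open>2 j - N\<close> is the sum of \<open>N\<close> independent random signs.\<close>

lemma sum_binomial_exp_linear_square:
  assumes "0 \<le> t" "t \<le> 1/8"
  shows "(\<Sum>j\<le>N. real (N choose j) / 2 ^ N *
             exp (x * (2 * real j - real N) + t * ((2 * real j - real N)\<^sup>2 / real N)))
    \<le> exp (2 * real N * x\<^sup>2 + 4 * t)"
proof (cases "N = 0")
  case True
  then show ?thesis using assms by simp
next
  case False
  define a where "a j = 2 * real j - real N" for j
  define w where "w j = real (N choose j) / 2 ^ N" for j
  have w_nonneg: "0 \<le> w j" for j by (simp add: w_def)
  have w_sum: "(\<Sum>j\<le>N. w j) = 1"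
  proof -
    have "(\<Sum>j\<le>N. real (N choose j)) = 2 ^ N"
      using choose_row_sum[of N] by (metis of_nat_numeral of_nat_power of_nat_sum)
    then show ?thesis by (simp add: w_def flip: sum_divide_distrib)
  qed
  have lin: "(\<Sum>j\<le>N. w j * exp (2 * x * a j)) \<le> exp (2 * real N * x\<^sup>2)"
  proof -
    have "(\<Sum>j\<le>N. real (N choose j) * exp (2 * x * a j)) = (exp (2 * x) + exp (- (2 * x))) ^ N"
    proof (subst binomial_ring, intro sum.cong refl)
      fix j assume "j \<in> {..N}"
      then show "real (N choose j) * exp (2 * x * a j)
          = of_nat (N choose j) * exp (2 * x) ^ j * exp (- (2 * x)) ^ (N - j)"
        by (simp add: a_def exp_of_nat_mult[symmetric] exp_add[symmetric] of_nat_diff)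
           (simp add: algebra_simps)
    qed
    then have "(\<Sum>j\<le>N. w j * exp (2 * x * a j)) = cosh (2 * x) ^ N"
      by (simp add: w_def cosh_field_def power_divide flip: sum_divide_distrib)
    also have "\<dots> \<le> exp ((2 * x)\<^sup>2 / 2) ^ N"
      by (intro power_mono cosh_le_exp_half_square) simp
    also have "\<dots> = exp (2 * real N * x\<^sup>2)"
      by (simp add: exp_of_nat_mult[symmetric] power2_eq_square)
    finally show ?thesis .
  qed
  have quad: "(\<Sum>j\<le>N. w j * exp (2 * (t * ((a j)\<^sup>2 / real N)))) \<le> exp (4 * t)"
  proof -
    \<comment> \<open>The coefficient b = 1/(4 N) makes 1 - 2 b N equal to 1/2.\<close>
    have M: "(\<Sum>j\<le>N. w j * exp ((a j)\<^sup>2 / (4 * real N))) \<le> 3/2"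
    proof -
      have "(\<Sum>j\<le>N. real (N choose j) * exp ((1 / (4 * real N)) * (a j)\<^sup>2)) \<le> 2 ^ N / sqrt (1 / 2)"
        using sum_binomial_exp_square[of "1 / (4 * real N)" N] False by (simp add: a_def)
      then have "(\<Sum>j\<le>N. w j * exp ((a j)\<^sup>2 / (4 * real N))) \<le> 1 / sqrt (1 / 2)"
        by (simp add: w_def divide_simps flip: sum_divide_distrib)
      also have "\<dots> \<le> 3/2"
        using real_le_rsqrt[of "2/3" "1/2"] by (simp add: divide_simps power2_eq_square)
      finally show ?thesis .
    qed
    \<comment> \<open>Convexity of exp between 0 and \<open>(a j)\<^sup>2 / (4 * real N)\<close>
      with weight 8 t <= 1. Interpolating from the fixed moment at t = 1/8 makes the final exponent
      linear in t.\<close>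
    have conv: "exp (2 * (t * ((a j)\<^sup>2 / real N))) \<le> (1 - 8 * t) + 8 * t * exp ((a j)\<^sup>2 / (4 * real N))" for j
    proof -
      have "exp ((1 - 8 * t) *\<^sub>R 0 + (8 * t) *\<^sub>R ((a j)\<^sup>2 / (4 * real N)))
          \<le> (1 - 8 * t) * exp 0 + (8 * t) * exp ((a j)\<^sup>2 / (4 * real N))"
        using assms by (intro convex_onD[OF exp_convex]) auto
      then show ?thesis by simp
    qed
    have "(\<Sum>j\<le>N. w j * exp (2 * (t * ((a j)\<^sup>2 / real N))))
        \<le> (\<Sum>j\<le>N. w j * ((1 - 8 * t) + 8 * t * exp ((a j)\<^sup>2 / (4 * real N))))"
      by (intro sum_mono mult_left_mono conv w_nonneg)
    also have "\<dots> = (1 - 8 * t) * (\<Sum>j\<le>N. w j) + 8 * t * (\<Sum>j\<le>N. w j * exp ((a j)\<^sup>2 / (4 * real N)))"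
      by (simp add: sum.distrib sum_subtractf sum_distrib_left sum_distrib_right algebra_simps)
    also have "\<dots> \<le> (1 - 8 * t) + 8 * t * (3/2)"
      unfolding w_sum using M assms by (intro add_mono mult_left_mono) auto
    also have "\<dots> = 1 + 4 * t" by simp
    also have "\<dots> \<le> exp (4 * t)" by (rule exp_ge_add_one_self)
    finally show ?thesis .
  qed
  \<comment> \<open>Convexity at the midpoint separates the dependent linear and quadratic terms, at
    the price of doubling both exponents.\<close>
  have two: "exp (u + v) \<le> exp (2 * u) / 2 + exp (2 * v) / 2" for u v :: real
  proof -
    have "exp ((1 - 1/2) *\<^sub>R (2 * u) + (1/2) *\<^sub>R (2 * v)) \<le> (1 - 1/2) * exp (2 * u) + (1/2) * exp (2 * v)"
      by (intro convex_onD[OF exp_convex]) auto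
    then show ?thesis by simp
  qed
  have "(\<Sum>j\<le>N. w j * exp (x * a j + t * ((a j)\<^sup>2 / real N)))
      \<le> (\<Sum>j\<le>N. w j * (exp (2 * (x * a j)) / 2 + exp (2 * (t * ((a j)\<^sup>2 / real N))) / 2))"
    by (intro sum_mono mult_left_mono two w_nonneg)
  also have "\<dots> = (\<Sum>j\<le>N. w j * exp (2 * x * a j)) / 2
      + (\<Sum>j\<le>N. w j * exp (2 * (t * ((a j)\<^sup>2 / real N)))) / 2"
    by (simp add: distrib_left sum.distrib sum_divide_distrib mult.assoc)
  also have "\<dots> \<le> exp (2 * real N * x\<^sup>2) / 2 + exp (4 * t) / 2"
    using lin quad by simp
  also have "\<dots> \<le> exp (2 * real N * x\<^sup>2 + 4 * t) / 2 + exp (2 * real N * x\<^sup>2 + 4 * t) / 2"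
    using assms by (intro add_mono divide_right_mono) auto
  finally show ?thesis by (simp add: a_def w_def)
qed

section \<open>Exponential moments of the bisection cost\<close>

type_synonym interval_pair = "real \<times> real \<times> real \<times> real"

text \<open>\<open>(\<alpha>, s, a, w)\<close> stands for the affine map from \<open>[\<alpha>, \<alpha> + s)\<close> onto \<open>[a, a + w)\<close>; \<open>disp\<close> is
  its mean squared displacement.\<close>

fun disp :: "interval_pair \<Rightarrow> real" where
  "disp (\<alpha>, s, a, w) = ((a + w / 2) - (\<alpha> + s / 2))\<^sup>2 + (w - s)\<^sup>2 / 12"

fun lower :: "real \<Rightarrow> interval_pair \<Rightarrow> interval_pair" where
  "lower p (\<alpha>, s, a, w) = (\<alpha>, s / 2, a, p * w)"

fun upper :: "real \<Rightarrow> interval_pair \<Rightarrow> interval_pair" where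
  "upper p (\<alpha>, s, a, w) = (\<alpha> + s / 2, s / 2, a + p * w, (1 - p) * w)"

text \<open>The list holds the numbers of points in the \<open>2 ^ d\<close> cells of a rectangle that is bisected
  \<open>d\<close> times, in alternating directions, the first one being that of \<open>I\<close>. The target rectangle is
  cut in proportion to the numbers of points.\<close>

fun cost :: "nat \<Rightarrow> interval_pair \<Rightarrow> interval_pair \<Rightarrow> nat list \<Rightarrow> real" where
  "cost 0 I J xs = real (sum_list xs) * (disp I + disp J)"
| "cost (Suc d) I J xs =
    (let p = real (sum_list (take (2 ^ d) xs)) / real (sum_list xs)
     in cost d J (lower p I) (take (2 ^ d) xs) + cost d J (upper p I) (drop (2 ^ d) xs))"

lemma disp_nonneg: "0 \<le> disp I"
  by (cases I) simp

declare disp.simps [simp del]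

lemma cost_nonneg: "0 \<le> cost d I J xs"
  by (induction d I J xs rule: cost.induct) (auto simp: disp_nonneg Let_def)

text \<open>The term that is linear in the imbalance \<open>2 j - N\<close> has mean zero for a binomial \<open>j\<close>.\<close>

lemma disp_split:
  assumes "j \<le> N"
  shows "real j * disp (lower (real j / real N) (\<alpha>, s, a, w))
       + real (N - j) * disp (upper (real j / real N) (\<alpha>, s, a, w))
     = real N * disp (\<alpha>, s, a, w) + ((a + w / 2) - (\<alpha> + s / 2)) * s / 2 * (2 * real j - real N)
       + w * s / 12 * ((2 * real j - real N)\<^sup>2 / real N)"
proof (cases "N = 0")
  case False
  define h where "h = (a + w / 2) - (\<alpha> + s / 2)"
  define p where "p = real j / real N"
  have a: "a = h - w / 2 + (\<alpha> + s / 2)" by (simp add: h_def)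
  have j: "real j = p * real N" "real (N - j) = (1 - p) * real N"
    using False assms by (auto simp: p_def of_nat_diff algebra_simps)
  have sq: "(2 * (p * real N) - real N)\<^sup>2 / real N = real N * (2 * p - 1)\<^sup>2"
    using False by (simp add: field_simps power2_eq_square)
  show ?thesis
    unfolding p_def[symmetric] unfolding j sq a
    by (simp add: disp.simps power2_eq_square field_simps)
qed (use assms in simp)

section \<open>Poisson weights and the exponential moment of the cost\<close>

definition poisson_weight :: "real \<Rightarrow> nat \<Rightarrow> real" where
  "poisson_weight m N = m ^ N / fact N * exp (- m)"

lemma poisson_weight_nonneg: "0 \<le> m \<Longrightarrow> 0 \<le> poisson_weight m N"
  by (simp add: poisson_weight_def)

text \<open>Two independent Poisson variables of mean m, conditioned on their sum N, split it
  binomially with probability 1/2.\<close>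

lemma poisson_weight_mult:
  assumes "j \<le> N"
  shows "poisson_weight m j * poisson_weight m (N - j)
    = poisson_weight (2 * m) N * (real (N choose j) / 2 ^ N)"
proof -
  have "m ^ j * m ^ (N - j) = m ^ N" using assms by (simp flip: power_add)
  moreover have "exp (- m) * exp (- m) = exp (- (2 * m))" by (simp add: mult_exp_exp)
  moreover have "poisson_weight m j * poisson_weight m (N - j)
      = (m ^ j * m ^ (N - j)) * (exp (- m) * exp (- m)) / (fact j * fact (N - j))"
    by (simp add: poisson_weight_def)
  ultimately show ?thesis using assms
    by (simp add: poisson_weight_def binomial_fact power_mult_distrib)
qed

text \<open>One bisection, with N points in total. By \<open>disp_split\<close> the exponent is its
  old value plus x times the imbalance plus t times the squared imbalance over N. The binomial
  moment turns the linear part into a variance term, absorbed by raising the factor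
  \<open>th\<close> on the cost by 2 l s^2, and the quadratic part into l s w. \<open>D\<close> is
  the displacement in the direction that is not cut.\<close>

lemma sum_poisson_exp_cost_le:
  fixes l th :: real and \<alpha> s a w D B :: real
  assumes l: "0 \<le> l" "0 \<le> s" "0 \<le> w" "0 \<le> th" "th \<le> 2" "l * (w * s) \<le> 3/4"
    and D: "0 \<le> D" and m: "0 \<le> m"
  shows "(\<Sum>j\<le>N. poisson_weight m j * exp (l * th * (real j * (D + disp (lower (real j / real N) (\<alpha>, s, a, w)))))
       * (poisson_weight m (N - j) * exp (l * th * (real (N - j) * (D + disp (upper (real j / real N) (\<alpha>, s, a, w)))))))
    \<le> poisson_weight (2 * m) N * exp (l * (th + 2 * l * s\<^sup>2) * (real N * (disp (\<alpha>, s, a, w) + D)) + l * (s * w))"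
    (is "?L \<le> ?R")
proof -
  define h where "h = (a + w / 2) - (\<alpha> + s / 2)"
  define K where "K = l * th * (real N * (disp (\<alpha>, s, a, w) + D))"
  define x where "x = l * th * h * s / 2"
  define t where "t = l * th * w * s / 12"
  \<comment> \<open>The bounds 2 and 3/4 in the hypotheses are what brings t below the 1/8 demanded
    by the binomial moment.\<close>
  have "th * (l * (w * s)) \<le> 2 * (3/4)" using l by (intro mult_mono) auto
  then have t: "0 \<le> t" "t \<le> 1/8" using l by (auto simp: t_def algebra_simps)
  have summand: "poisson_weight m j * exp (l * th * (real j * (D + disp (lower (real j / real N) (\<alpha>, s, a, w)))))
       * (poisson_weight m (N - j) * exp (l * th * (real (N - j) * (D + disp (upper (real j / real N) (\<alpha>, s, a, w))))))
     = poisson_weight (2 * m) N * exp K * (real (N choose j) / 2 ^ N *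
             exp (x * (2 * real j - real N) + t * ((2 * real j - real N)\<^sup>2 / real N)))"
    (is "?u * ?e1 * (?v * ?e2) = _") if "j \<le> N" for j
  proof -
    have Dsum: "real j * D + real (N - j) * D = real N * D" using that by (simp add: of_nat_diff algebra_simps)
    have "?e1 * ?e2 = exp (l * th * ((real j * disp (lower (real j / real N) (\<alpha>, s, a, w))
       + real (N - j) * disp (upper (real j / real N) (\<alpha>, s, a, w))) + (real j * D + real (N - j) * D)))"
      unfolding exp_add[symmetric] by (simp only: distrib_left ac_simps)
    also have "\<dots> = exp (K + (x * (2 * real j - real N) + t * ((2 * real j - real N)\<^sup>2 / real N)))"
      unfolding disp_split[OF that] Dsum h_def[symmetric] K_def x_def t_def by (simp add: field_simps)
    finally have "?e1 * ?e2 = exp K * exp (x * (2 * real j - real N) + t * ((2 * real j - real N)\<^sup>2 / real N))"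
      by (simp add: exp_add)
    moreover have "?u * ?e1 * (?v * ?e2) = (?u * ?v) * (?e1 * ?e2)" by (simp only: ac_simps)
    ultimately show ?thesis unfolding poisson_weight_mult[OF that] by (simp add: ac_simps)
  qed
  have "?L = poisson_weight (2 * m) N * exp K * (\<Sum>j\<le>N. real (N choose j) / 2 ^ N *
             exp (x * (2 * real j - real N) + t * ((2 * real j - real N)\<^sup>2 / real N)))"
    unfolding sum_distrib_left by (intro sum.cong refl summand) auto
  also have "\<dots> \<le> poisson_weight (2 * m) N * exp K * exp (2 * real N * x\<^sup>2 + 4 * t)"
    using m t by (intro mult_left_mono sum_binomial_exp_linear_square) (auto intro!: poisson_weight_nonneg mult_nonneg_nonneg)
  also have "\<dots> = poisson_weight (2 * m) N * exp (K + 2 * real N * x\<^sup>2 + 4 * t)"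
    by (simp add: exp_add)
  also have "\<dots> \<le> ?R"
  proof (rule mult_left_mono)
    \<comment> \<open>The variance term is quadratic in the distance h of the midpoints, and h^2 is
      one of the two summands of \<open>disp\<close>; so it is a multiple of the current
      cost.\<close>
    have th2: "th * th \<le> 2 * 2" using l by (intro mult_mono) auto
    have "2 * real N * x\<^sup>2 = (th * th) * (l\<^sup>2 * s\<^sup>2 * real N * h\<^sup>2 / 2)"
      by (simp add: x_def power2_eq_square)
    also have "\<dots> \<le> (2 * 2) * (l\<^sup>2 * s\<^sup>2 * real N * h\<^sup>2 / 2)"
      by (intro mult_right_mono th2) auto
    also have "\<dots> = l * (2 * l * s\<^sup>2) * (real N * h\<^sup>2)"
      by (simp add: power2_eq_square)
    also have "\<dots> \<le> l * (2 * l * s\<^sup>2) * (real N * (disp (\<alpha>, s, a, w) + D))"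
      using l D by (intro mult_left_mono) (auto simp: h_def disp.simps)
    finally have X: "2 * real N * x\<^sup>2 \<le> l * (2 * l * s\<^sup>2) * (real N * (disp (\<alpha>, s, a, w) + D))" .
    have "th * (l * (s * w)) \<le> 3 * (l * (s * w))" using l by (intro mult_right_mono) auto
    then have "4 * t \<le> l * (s * w)" by (simp add: t_def algebra_simps)
    with X have "K + 2 * real N * x\<^sup>2 + 4 * t
      \<le> K + l * (2 * l * s\<^sup>2) * (real N * (disp (\<alpha>, s, a, w) + D)) + l * (s * w)" by linarith
    then show "exp (K + 2 * real N * x\<^sup>2 + 4 * t)
      \<le> exp (l * (th + 2 * l * s\<^sup>2) * (real N * (disp (\<alpha>, s, a, w) + D)) + l * (s * w))"
      by (simp add: K_def distrib_left distrib_right)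
  qed (simp_all add: poisson_weight_nonneg m)
  finally show ?thesis .
qed

lemma nn_integral_replicate_pmf_add:
  "(\<integral>\<^sup>+ xs. f xs \<partial>measure_pmf (replicate_pmf (m + n) p))
    = (\<integral>\<^sup>+ xs. \<integral>\<^sup>+ ys. f (xs @ ys) \<partial>measure_pmf (replicate_pmf n p) \<partial>measure_pmf (replicate_pmf m p))"
  by (simp add: replicate_pmf_distrib)

text \<open>Induction on the depth, with the number of points fixed so that the two halves decouple.
  A cut of side s raises the factor on the cost by 2 l s^2; as sides halve, these increments sum to
  at most 8/3 l (s^2 + s'^2), hence the 3. A cut also adds l s w. The weight s w + 2 s' w' dominates
  this and is conserved: the children, whose roles are swapped, have the weights s' w' + p s w and
  s' w' + (1 - p) s w, with the same sum.\<close>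

lemma nn_integral_exp_cost_le:
  assumes l: "0 \<le> l" and s: "0 \<le> s" "0 \<le> s'" and w: "0 \<le> w" "0 \<le> w'"
    and small: "3 * l * (s\<^sup>2 + s'\<^sup>2) \<le> 1" "l * (w * s) \<le> 3/4" "l * (w' * s') \<le> 3/4"
  shows "(\<integral>\<^sup>+ xs. ennreal (exp (l * cost d (\<alpha>, s, a, w) (\<alpha>', s', a', w') xs)) * indicator {xs. sum_list xs = N} xs
            \<partial>measure_pmf (replicate_pmf (2 ^ d) (poisson_pmf 1)))
    \<le> ennreal (poisson_weight (2 ^ d) N
        * exp (l * (1 + 3 * l * (s\<^sup>2 + s'\<^sup>2)) * (real N * (disp (\<alpha>, s, a, w) + disp (\<alpha>', s', a', w')))
               + l * real d * (s * w + 2 * (s' * w'))))"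
  using s w small
proof (induction d arbitrary: \<alpha> s a w \<alpha>' s' a' w' N)
  case 0
  define A where "A = real N * (disp (\<alpha>, s, a, w) + disp (\<alpha>', s', a', w'))"
  have A: "0 \<le> A" unfolding A_def by (intro mult_nonneg_nonneg add_nonneg_nonneg disp_nonneg) auto
  have "(\<integral>\<^sup>+ xs. ennreal (exp (l * cost 0 (\<alpha>, s, a, w) (\<alpha>', s', a', w') xs)) * indicator {xs. sum_list xs = N} xs
            \<partial>measure_pmf (replicate_pmf (2 ^ 0) (poisson_pmf 1)))
      = (\<integral>\<^sup>+ n. ennreal (exp (l * A)) * indicator {N} n \<partial>measure_pmf (poisson_pmf 1))"
    unfolding power_0 replicate_pmf_1 nn_integral_map_pmf
    by (intro nn_integral_cong) (auto simp: A_def split: split_indicator)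
  also have "\<dots> = ennreal (exp (l * A)) * ennreal (poisson_weight 1 N)"
    by (subst nn_integral_cmult_indicator) (auto simp: emeasure_pmf_single poisson_weight_def)
  also have "\<dots> = ennreal (poisson_weight 1 N * exp (l * A))"
    by (simp add: ennreal_mult' poisson_weight_nonneg mult.commute)
  also have "\<dots> \<le> ennreal (poisson_weight 1 N * exp (l * (1 + 3 * l * (s\<^sup>2 + s'\<^sup>2)) * A))"
  proof (intro ennreal_leI mult_left_mono)
    have "0 \<le> l * (3 * l * (s\<^sup>2 + s'\<^sup>2)) * A" using l A by simp
    then show "exp (l * A) \<le> exp (l * (1 + 3 * l * (s\<^sup>2 + s'\<^sup>2)) * A)" by (simp add: algebra_simps)
  qed (simp add: poisson_weight_nonneg)
  finally show ?case by (simp add: A_def)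
next
  case (Suc d)
  let ?R = "measure_pmf (replicate_pmf (2 ^ d) (poisson_pmf 1))"
  let ?I = "(\<alpha>, s, a, w)" and ?J = "(\<alpha>', s', a', w')"
  define F where "F j xs = ennreal (exp (l * cost d ?J (lower (real j / real N) ?I) xs)) * indicator {xs. sum_list xs = j} xs" for j xs
  define G where "G j xs = ennreal (exp (l * cost d ?J (upper (real j / real N) ?I) xs)) * indicator {xs. sum_list xs = N - j} xs" for j xs
  define D where "D = disp ?J"
  \<comment> \<open>The factor of the two children: their sides are s' and s/2, with s' to be cut
    next.\<close>
  define th where "th = 1 + 3 * l * (s'\<^sup>2 + (s / 2)\<^sup>2)"
  define b where "b j = l * real d * (s' * w' + 2 * (s / 2 * (real j / real N * w)))" for j
  define b' where "b' j = l * real d * (s' * w' + 2 * (s / 2 * ((1 - real j / real N) * w)))" for j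
  have child: "3 * l * (s'\<^sup>2 + (s / 2)\<^sup>2) \<le> 1"
  proof -
    have "3 * l * (s'\<^sup>2 + (s / 2)\<^sup>2) \<le> 3 * l * (s\<^sup>2 + s'\<^sup>2)"
      using l by (intro mult_left_mono) (auto simp: power_divide)
    with Suc.prems show ?thesis by linarith
  qed
  have small': "l * (p * w * (s / 2)) \<le> 3/4" if "0 \<le> p" "p \<le> 1" for p
  proof -
    have "p * (l * (w * s)) \<le> 1 * (l * (w * s))"
      using l Suc.prems that by (intro mult_right_mono) auto
    with Suc.prems that l show ?thesis by (auto simp: algebra_simps)
  qed
  have F: "(\<integral>\<^sup>+ xs. F j xs \<partial>?R) \<le> ennreal (poisson_weight (2 ^ d) j
      * exp (l * th * (real j * (D + disp (lower (real j / real N) ?I))) + b j))" if "j \<le> N" for j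
  proof -
    have p: "0 \<le> real j / real N" "real j / real N \<le> 1" using that by (auto simp: divide_simps)
    show ?thesis
      unfolding F_def th_def b_def D_def lower.simps
      using l Suc.prems child small'[OF p] p by (intro Suc.IH) auto
  qed
  have G: "(\<integral>\<^sup>+ xs. G j xs \<partial>?R) \<le> ennreal (poisson_weight (2 ^ d) (N - j)
      * exp (l * th * (real (N - j) * (D + disp (upper (real j / real N) ?I))) + b' j))" if "j \<le> N" for j
  proof -
    have p: "0 \<le> real j / real N" "real j / real N \<le> 1" using that by (auto simp: divide_simps)
    show ?thesis
      unfolding G_def th_def b'_def D_def upper.simps
      using l Suc.prems child small'[of "1 - real j / real N"] p by (intro Suc.IH) auto
  qed
  \<comment> \<open>The indicators leave only the summand in which j is the number of points of the
    first half.\<close>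
  have split: "ennreal (exp (l * cost (Suc d) ?I ?J (xs @ ys))) * indicator {xs. sum_list xs = N} (xs @ ys)
      = (\<Sum>j\<le>N. F j xs * G j ys)" if "length xs = 2 ^ d" for xs ys
  proof (cases "sum_list xs + sum_list ys = N")
    case True
    have "(\<Sum>j\<le>N. F j xs * G j ys) = (\<Sum>j\<in>{sum_list xs}. F j xs * G j ys)"
      using True by (intro sum.mono_neutral_right) (auto simp: F_def)
    also have "\<dots> = ennreal (exp (l * cost (Suc d) ?I ?J (xs @ ys)))"
      using True that l
      by (auto simp: F_def G_def Let_def distrib_left exp_add ennreal_mult' simp flip: of_nat_add)
    finally show ?thesis using True by simp
  next
    case False
    then have "F j xs * G j ys = 0" if "j \<le> N" for j
      using that by (auto simp: F_def G_def split: split_indicator)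
    then show ?thesis using False by auto
  qed
  have "(\<integral>\<^sup>+ xs. ennreal (exp (l * cost (Suc d) ?I ?J xs)) * indicator {xs. sum_list xs = N} xs
            \<partial>measure_pmf (replicate_pmf (2 ^ Suc d) (poisson_pmf 1)))
      = (\<integral>\<^sup>+ xs. \<integral>\<^sup>+ ys. (\<Sum>j\<le>N. F j xs * G j ys) \<partial>?R \<partial>?R)"
    unfolding power_Suc mult_2 nn_integral_replicate_pmf_add
    by (intro nn_integral_cong_AE) (auto simp: AE_measure_pmf_iff set_replicate_pmf split simp del: cost.simps intro!: nn_integral_cong)
  also have "\<dots> = (\<Sum>j\<le>N. (\<integral>\<^sup>+ xs. F j xs \<partial>?R) * (\<integral>\<^sup>+ xs. G j xs \<partial>?R))"
    by (simp add: nn_integral_sum nn_integral_cmult nn_integral_multc)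
  also have "\<dots> \<le> (\<Sum>j\<le>N. ennreal (poisson_weight (2 ^ d) j
      * exp (l * th * (real j * (D + disp (lower (real j / real N) ?I))) + b j)) * ennreal (poisson_weight (2 ^ d) (N - j)
      * exp (l * th * (real (N - j) * (D + disp (upper (real j / real N) ?I))) + b' j)))"
    by (intro sum_mono mult_mono F G) auto
  also have "\<dots> = ennreal (\<Sum>j\<le>N. (poisson_weight (2 ^ d) j
      * exp (l * th * (real j * (D + disp (lower (real j / real N) ?I))) + b j)) * (poisson_weight (2 ^ d) (N - j)
      * exp (l * th * (real (N - j) * (D + disp (upper (real j / real N) ?I))) + b' j)))"
    by (subst sum_ennreal[symmetric]) (auto simp: ennreal_mult poisson_weight_nonneg)
  also have "(\<Sum>j\<le>N. (poisson_weight (2 ^ d) j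
      * exp (l * th * (real j * (D + disp (lower (real j / real N) ?I))) + b j)) * (poisson_weight (2 ^ d) (N - j)
      * exp (l * th * (real (N - j) * (D + disp (upper (real j / real N) ?I))) + b' j)))
    = exp (l * real d * (s * w + 2 * (s' * w'))) * (\<Sum>j\<le>N. poisson_weight (2 ^ d) j
        * exp (l * th * (real j * (D + disp (lower (real j / real N) ?I)))) * (poisson_weight (2 ^ d) (N - j)
        * exp (l * th * (real (N - j) * (D + disp (upper (real j / real N) ?I))))))"
  proof -
    \<comment> \<open>Conservation of the weight: the proportions j/N and 1 - j/N add up to 1, so
      the product no longer depends on j and leaves the sum.\<close>
    have eb: "exp (b j) * exp (b' j) = exp (l * real d * (s * w + 2 * (s' * w')))" for j
      unfolding b_def b'_def exp_add[symmetric] by (simp add: algebra_simps)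
    show ?thesis
      unfolding sum_distrib_left
    proof (intro sum.cong refl)
      fix j
      show "poisson_weight (2 ^ d) j * exp (l * th * (real j * (D + disp (lower (real j / real N) ?I))) + b j)
          * (poisson_weight (2 ^ d) (N - j)
          * exp (l * th * (real (N - j) * (D + disp (upper (real j / real N) ?I))) + b' j))
        = exp (l * real d * (s * w + 2 * (s' * w'))) * (poisson_weight (2 ^ d) j
          * exp (l * th * (real j * (D + disp (lower (real j / real N) ?I)))) * (poisson_weight (2 ^ d) (N - j)
          * exp (l * th * (real (N - j) * (D + disp (upper (real j / real N) ?I))))))"
        unfolding exp_add eb[of j, symmetric] by (simp only: ac_simps)
    qed
  qed
  also have "\<dots> \<le> exp (l * real d * (s * w + 2 * (s' * w'))) * (poisson_weight (2 * 2 ^ d) N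
      * exp (l * (th + 2 * l * s\<^sup>2) * (real N * (disp ?I + D)) + l * (s * w)))"
    using l Suc.prems child
    by (intro mult_left_mono sum_poisson_exp_cost_le) (auto simp: th_def D_def intro: disp_nonneg)
  also have "\<dots> \<le> poisson_weight (2 ^ Suc d) N * exp (l * (1 + 3 * l * (s\<^sup>2 + s'\<^sup>2)) * (real N * (disp ?I + D))
               + l * real (Suc d) * (s * w + 2 * (s' * w')))"
  proof -
    \<comment> \<open>The coefficient of l s^2 is 3/4 from the children plus 2 from this cut, at
      most 3.\<close>
    have "l * (th + 2 * l * s\<^sup>2) * (real N * (disp ?I + D)) \<le> l * (1 + 3 * l * (s\<^sup>2 + s'\<^sup>2)) * (real N * (disp ?I + D))"
      using l by (intro mult_right_mono mult_left_mono)
        (auto simp: th_def D_def power_divide algebra_simps intro!: disp_nonneg add_nonneg_nonneg mult_nonneg_nonneg)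
    moreover have "l * (s * w) \<le> l * (s * w + 2 * (s' * w'))"
      using l Suc.prems by (intro mult_left_mono) auto
    ultimately have "exp (l * real d * (s * w + 2 * (s' * w')) + (l * (th + 2 * l * s\<^sup>2) * (real N * (disp ?I + D)) + l * (s * w)))
        \<le> exp (l * (1 + 3 * l * (s\<^sup>2 + s'\<^sup>2)) * (real N * (disp ?I + D))
               + l * real (Suc d) * (s * w + 2 * (s' * w')))"
      by (simp add: distrib_left distrib_right)
    from mult_left_mono[OF this poisson_weight_nonneg[of "2 ^ Suc d" N]] show ?thesis
      by (simp add: exp_add[symmetric] mult.left_commute)
  qed
  finally show ?case by (simp add: D_def ennreal_leI)
qed

section \<open>Transport plans\<close>

text \<open>The flag records which interval is horizontal, so that the two directions can swap roles
  at each bisection.\<close>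

definition rect :: "bool \<Rightarrow> real set \<Rightarrow> real set \<Rightarrow> plane set" where
  "rect v A B = (if v then A \<times> B else B \<times> A)"

lemma rect_flip: "rect (\<not> v) B A = rect v A B"
  by (simp add: rect_def)

lemma rect_Un: "rect v (A \<union> A') B = rect v A B \<union> rect v A' B"
  by (auto simp: rect_def)

lemma rect_disjoint: "A \<inter> A' = {} \<Longrightarrow> rect v A B \<inter> rect v A' B = {}"
  by (auto simp: rect_def)

lemma rect_borel [measurable]: "rect v {a..<b} {c..<d} \<in> sets borel"
  by (auto simp: rect_def intro!: borel_Times)

lemma emeasure_lborel_rect:
  assumes "0 \<le> s" "0 \<le> t"
  shows "emeasure lborel (rect v {a..<a + s} {b..<b + t}) = ennreal (s * t)"
proof -
  have "emeasure (lborel \<Otimes>\<^sub>M lborel) ({a..<a + s} \<times> {b..<b + t}) = ennreal (s * t)"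
       "emeasure (lborel \<Otimes>\<^sub>M lborel) ({b..<b + t} \<times> {a..<a + s}) = ennreal (s * t)"
    using assms by (subst lborel.emeasure_pair_measure_Times; simp add: ennreal_mult mult.commute)+
  then show ?thesis by (simp add: rect_def lborel_prod)
qed

text \<open>The order is such that \<open>take\<close> and \<open>drop\<close> in
  \<open>cost\<close> pick out the cells of the two halves.\<close>

fun cells :: "nat \<Rightarrow> bool \<Rightarrow> real \<times> real \<Rightarrow> real \<times> real \<Rightarrow> plane set list" where
  "cells 0 v (\<alpha>, s) (\<beta>, t) = [rect v {\<alpha>..<\<alpha> + s} {\<beta>..<\<beta> + t}]"
| "cells (Suc d) v (\<alpha>, s) (\<beta>, t)
    = cells d (\<not> v) (\<beta>, t) (\<alpha>, s / 2) @ cells d (\<not> v) (\<beta>, t) (\<alpha> + s / 2, s / 2)"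

lemma length_cells [simp]: "length (cells d v I J) = 2 ^ d"
  by (induction d v I J rule: cells.induct) auto

lemma cells_borel: "C \<in> set (cells d v I J) \<Longrightarrow> C \<in> sets borel"
  by (induction d v I J rule: cells.induct) auto

lemma interval_split:
  fixes a c w :: real
  assumes "0 \<le> c" "c \<le> w"
  shows "{a..<a + w} = {a..<a + c} \<union> {a + c..<a + c + (w - c)}"
  using assms by auto

lemma Union_cells:
  "0 \<le> s \<Longrightarrow> 0 \<le> t \<Longrightarrow> \<Union> (set (cells d v (\<alpha>, s) (\<beta>, t))) = rect v {\<alpha>..<\<alpha> + s} {\<beta>..<\<beta> + t}"
proof (induction d arbitrary: v \<alpha> s \<beta> t)
  case (Suc d)
  then have "\<Union> (set (cells (Suc d) v (\<alpha>, s) (\<beta>, t)))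
      = rect (\<not> v) {\<beta>..<\<beta> + t} {\<alpha>..<\<alpha> + s / 2} \<union> rect (\<not> v) {\<beta>..<\<beta> + t} {\<alpha> + s / 2..<\<alpha> + s / 2 + s / 2}"
    by simp
  also have "\<dots> = rect v {\<alpha>..<\<alpha> + s} {\<beta>..<\<beta> + t}"
    unfolding rect_flip rect_Un[symmetric] using interval_split[of "s / 2" s \<alpha>] Suc.prems by simp
  finally show ?case .
qed simp

lemma cells_disjoint:
  "0 \<le> s \<Longrightarrow> 0 \<le> t \<Longrightarrow> sorted_wrt (\<lambda>A B. A \<inter> B = {}) (cells d v (\<alpha>, s) (\<beta>, t))"
proof (induction d arbitrary: v \<alpha> s \<beta> t)
  case (Suc d)
  have "rect v {\<alpha>..<\<alpha> + s / 2} {\<beta>..<\<beta> + t} \<inter> rect v {\<alpha> + s / 2..<\<alpha> + s / 2 + s / 2} {\<beta>..<\<beta> + t} = {}"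
    by (intro rect_disjoint) auto
  then have "\<Union> (set (cells d (\<not> v) (\<beta>, t) (\<alpha>, s / 2))) \<inter> \<Union> (set (cells d (\<not> v) (\<beta>, t) (\<alpha> + s / 2, s / 2))) = {}"
    using Suc.prems by (simp add: Union_cells rect_flip)
  then have "A \<inter> B = {}" if "A \<in> set (cells d (\<not> v) (\<beta>, t) (\<alpha>, s / 2))"
    "B \<in> set (cells d (\<not> v) (\<beta>, t) (\<alpha> + s / 2, s / 2))" for A B using that by blast
  with Suc show ?case by (simp add: sorted_wrt_append)
qed simp

lemma emeasure_lborel_cells:
  "0 \<le> s \<Longrightarrow> 0 \<le> t \<Longrightarrow> C \<in> set (cells d v (\<alpha>, s) (\<beta>, t)) \<Longrightarrow> emeasure lborel C = ennreal (s * t / 2 ^ d)"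
proof (induction d arbitrary: v \<alpha> s \<beta> t)
  case (Suc d)
  from Suc.prems(3) consider "C \<in> set (cells d (\<not> v) (\<beta>, t) (\<alpha>, s / 2))"
    | "C \<in> set (cells d (\<not> v) (\<beta>, t) (\<alpha> + s / 2, s / 2))" by auto
  then show ?case
  proof cases
    case 1
    with Suc.IH[OF _ _ 1] Suc.prems show ?thesis by (simp add: mult.commute)
  next
    case 2
    with Suc.IH[OF _ _ 2] Suc.prems show ?thesis by (simp add: mult.commute)
  qed
qed (simp add: emeasure_lborel_rect)

lemma sum_list_measure_cells:
  assumes "finite_measure \<mu>" "sets \<mu> = sets borel" "0 \<le> s" "0 \<le> t"
  shows "sum_list (map (measure \<mu>) (cells d v (\<alpha>, s) (\<beta>, t))) = measure \<mu> (rect v {\<alpha>..<\<alpha> + s} {\<beta>..<\<beta> + t})"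
proof -
  interpret finite_measure \<mu> by fact
  have "sum_list (map (measure \<mu>) Cs) = measure \<mu> (\<Union> (set Cs))"
    if "sorted_wrt (\<lambda>A B. A \<inter> B = {}) Cs" "set Cs \<subseteq> sets borel" for Cs
    using that
  proof (induction Cs)
    case (Cons C Cs)
    have "measure \<mu> (C \<union> \<Union> (set Cs)) = measure \<mu> C + measure \<mu> (\<Union> (set Cs))"
      using Cons.prems assms by (intro finite_measure_Union) auto
    with Cons show ?case by simp
  qed simp
  from this[OF cells_disjoint[OF assms(3,4)] subsetI[OF cells_borel]] show ?thesis
    using assms by (simp add: Union_cells)
qed

section \<open>Transport plans given by densities\<close>

text \<open>\<open>g\<close> is the density with respect to \<open>\<mu> \<otimes> Leb\<close> of a transport plan from \<open>\<mu> \<llcorner> q\<close> to \<open>\<rho>\<close> times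
  Lebesgue measure on \<open>R\<close>, of cost at most \<open>K\<close>.\<close>

definition transport_density ::
  "plane measure \<Rightarrow> real \<Rightarrow> plane set \<Rightarrow> plane set \<Rightarrow> (plane \<times> plane \<Rightarrow> ennreal) \<Rightarrow> ennreal \<Rightarrow> bool" where
  "transport_density \<mu> \<rho> q R g K \<longleftrightarrow>
     g \<in> borel_measurable (\<mu> \<Otimes>\<^sub>M lborel) \<and>
     (\<forall>A \<in> sets borel. (\<integral>\<^sup>+ z. g z * indicator (A \<times> UNIV) z \<partial>(\<mu> \<Otimes>\<^sub>M lborel)) = emeasure \<mu> (A \<inter> q)) \<and>
     (\<forall>A \<in> sets borel. (\<integral>\<^sup>+ z. g z * indicator (UNIV \<times> A) z \<partial>(\<mu> \<Otimes>\<^sub>M lborel)) = ennreal \<rho> * emeasure lborel (A \<inter> R)) \<and>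
     (\<integral>\<^sup>+ z. g z * ennreal ((norm (fst z - snd z))\<^sup>2) \<partial>(\<mu> \<Otimes>\<^sub>M lborel)) \<le> K"

lemma sets_pair_plane: "sets \<mu> = sets borel \<Longrightarrow> sets (\<mu> \<Otimes>\<^sub>M (lborel :: plane measure)) = sets (borel :: (plane \<times> plane) measure)" for \<mu> :: "plane measure"
  by (subst borel_prod[symmetric]) (intro sets_pair_measure_cong; simp)

lemma transport_density_add:
  assumes g: "transport_density \<mu> \<rho> q R g K" and g': "transport_density \<mu> \<rho> q' R' g' K'"
    and \<mu>: "sets \<mu> = sets borel" and [measurable]: "q \<in> sets borel" "q' \<in> sets borel" "R \<in> sets borel" "R' \<in> sets borel"
    and disj: "q \<inter> q' = {}" "R \<inter> R' = {}"
  shows "transport_density \<mu> \<rho> (q \<union> q') (R \<union> R') (\<lambda>z. g z + g' z) (K + K')"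
proof -
  let ?M = "\<mu> \<Otimes>\<^sub>M (lborel :: plane measure)"
  note [measurable_cong] = \<mu>
  have [measurable]: "g \<in> borel_measurable ?M" "g' \<in> borel_measurable ?M"
    using g g' by (auto simp: transport_density_def)
  have add: "(\<integral>\<^sup>+ z. (g z + g' z) * f z \<partial>?M) = (\<integral>\<^sup>+ z. g z * f z \<partial>?M) + (\<integral>\<^sup>+ z. g' z * f z \<partial>?M)"
    if [measurable]: "f \<in> borel_measurable ?M" for f
    by (simp add: distrib_right nn_integral_add)
  have [measurable]: "A \<times> UNIV \<in> sets ?M" "UNIV \<times> A \<in> sets ?M" if "A \<in> sets borel" for A :: "plane set"
    using that \<mu> by (auto simp: sets_pair_plane intro!: borel_Times)
  have "emeasure \<mu> (A \<inter> (q \<union> q')) = emeasure \<mu> (A \<inter> q) + emeasure \<mu> (A \<inter> q')" if "A \<in> sets borel" for A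
    unfolding Int_Un_distrib using that disj \<mu> by (intro plus_emeasure[symmetric]) auto
  moreover have "emeasure lborel (A \<inter> (R \<union> R')) = emeasure lborel (A \<inter> R) + emeasure lborel (A \<inter> R')" if "A \<in> sets borel" for A
    unfolding Int_Un_distrib using that disj by (intro plus_emeasure[symmetric]) auto
  ultimately show ?thesis
    using g g' by (simp add: transport_density_def add distrib_left add_mono)
qed

text \<open>The measure with density g is itself a coupling: the two marginal conditions on g
  compute its mass on the cylinders over A.\<close>

lemma W2_sq_le_transport_density:
  assumes g: "transport_density \<mu> \<rho> q R g K" and \<mu>: "sets \<mu> = sets borel" "finite_measure \<mu>"
    and [measurable]: "q \<in> sets borel" "R \<in> sets borel" and \<rho>: "0 \<le> \<rho>"
  shows "W2_sq (restr \<mu> q) (uniform_on \<rho> R) \<le> K"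
proof -
  let ?M = "\<mu> \<Otimes>\<^sub>M (lborel :: plane measure)"
  note [measurable_cong] = \<mu>(1)
  define \<gamma> where "\<gamma> = density ?M g"
  have gm [measurable]: "g \<in> borel_measurable ?M"
    using g by (auto simp: transport_density_def)
  have sets_M: "sets ?M = sets borel" by (rule sets_pair_plane[OF \<mu>(1)])
  have space: "space ?M = UNIV" using sets_eq_imp_space_eq[OF sets_M] by simp
  have Times: "A \<times> UNIV \<in> sets ?M" "UNIV \<times> A \<in> sets ?M" if "A \<in> sets borel" for A :: "plane set"
    using that \<mu> by (auto simp: sets_M intro!: borel_Times)
  have "distr \<gamma> borel fst = restr \<mu> q"
  proof (rule measure_eqI)
    fix A assume "A \<in> sets (distr \<gamma> borel fst)"
    then have A [measurable]: "A \<in> sets borel" by simp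
    have "emeasure (distr \<gamma> borel fst) A = emeasure \<gamma> (A \<times> UNIV)"
      by (subst emeasure_distr) (auto simp: \<gamma>_def space intro!: arg_cong2[where f=emeasure])
    also have "\<dots> = emeasure \<mu> (A \<inter> q)"
      using g A by (simp add: \<gamma>_def emeasure_density Times transport_density_def)
    also have "\<dots> = emeasure (restr \<mu> q) A"
      using \<mu> by (simp add: restr_def emeasure_density indicator_inter_arith[symmetric] mult.commute Int_commute)
    finally show "emeasure (distr \<gamma> borel fst) A = emeasure (restr \<mu> q) A" .
  qed (simp add: restr_def \<mu>)
  moreover have "distr \<gamma> borel snd = uniform_on \<rho> R"
  proof (rule measure_eqI)
    fix A assume "A \<in> sets (distr \<gamma> borel snd)"
    then have A [measurable]: "A \<in> sets borel" by simp
    have "emeasure (distr \<gamma> borel snd) A = emeasure \<gamma> (UNIV \<times> A)"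
      by (subst emeasure_distr) (auto simp: \<gamma>_def space intro!: arg_cong2[where f=emeasure])
    also have "\<dots> = ennreal \<rho> * emeasure lborel (A \<inter> R)"
      using g A by (simp add: \<gamma>_def emeasure_density Times transport_density_def)
    also have "\<dots> = emeasure (uniform_on \<rho> R) A"
      by (simp add: uniform_on_def emeasure_density mult.assoc nn_integral_cmult indicator_inter_arith[symmetric] Int_commute)
    finally show "emeasure (distr \<gamma> borel snd) A = emeasure (uniform_on \<rho> R) A" .
  qed (simp add: uniform_on_def)
  ultimately have "\<gamma> \<in> couplings (restr \<mu> q) (uniform_on \<rho> R)"
    by (simp add: couplings_def) (simp only: \<gamma>_def sets_density sets_M)
  then have "W2_sq (restr \<mu> q) (uniform_on \<rho> R) \<le> (\<integral>\<^sup>+ (x, y). ennreal ((norm (x - y))\<^sup>2) \<partial>\<gamma>)"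
    unfolding W2_sq_def by (rule INF_lower)
  also have "\<dots> = (\<integral>\<^sup>+ z. g z * ennreal ((norm (fst z - snd z))\<^sup>2) \<partial>?M)"
    unfolding \<gamma>_def by (subst nn_integral_density) (auto simp: case_prod_beta)
  also have "\<dots> \<le> K" using g by (simp add: transport_density_def)
  finally show ?thesis .
qed

text \<open>Both points lie within half a side of the midpoints, and (s + w)/2 <= |w - s|/2 + s with
  s <= 1. Squaring three summands costs a factor 3; the middle one becomes 3/4 (w - s)^2 = 9 (w -
  s)^2 / 12, whence the 9.\<close>

lemma square_diff_le_disp:
  assumes "x \<in> {\<alpha>..<\<alpha> + s}" "y \<in> {a..<a + w}" "s \<le> 1"
  shows "(x - y)\<^sup>2 \<le> 9 * disp (\<alpha>, s, a, w) + 3"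
proof -
  define h where "h = (a + w / 2) - (\<alpha> + s / 2)"
  have three: "(b + c + 1)\<^sup>2 \<le> 3 * (b\<^sup>2 + c\<^sup>2 + 1\<^sup>2)" for b c :: real
    using zero_le_power2[of "b - c"] zero_le_power2[of "b - 1"] zero_le_power2[of "c - 1"]
    by (simp add: power2_eq_square algebra_simps)
  have "\<bar>x - y\<bar> \<le> \<bar>h\<bar> + \<bar>w - s\<bar> / 2 + 1"
    using assms by (auto simp: h_def abs_if field_simps)
  then have "(x - y)\<^sup>2 \<le> (\<bar>h\<bar> + \<bar>w - s\<bar> / 2 + 1)\<^sup>2"
    by (metis abs_ge_zero power2_abs power_mono)
  also have "\<dots> \<le> 3 * (\<bar>h\<bar>\<^sup>2 + (\<bar>w - s\<bar> / 2)\<^sup>2 + 1\<^sup>2)"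
    by (rule three)
  also have "\<dots> \<le> 9 * disp (\<alpha>, s, a, w) + 3"
    by (simp add: disp.simps h_def[symmetric] power_divide)
  finally show ?thesis .
qed

lemma square_norm_diff_le_disp:
  assumes "x \<in> rect v {\<alpha>..<\<alpha> + s} {\<beta>..<\<beta> + t}" "y \<in> rect v {a..<a + w} {b..<b + u}" "s \<le> 1" "t \<le> 1"
  shows "(norm (x - y))\<^sup>2 \<le> 9 * (disp (\<alpha>, s, a, w) + disp (\<beta>, t, b, u)) + 6"
proof -
  obtain x1 x2 y1 y2 where xy: "x = (x1, x2)" "y = (y1, y2)" by (cases x; cases y) auto
  have "(norm (x - y))\<^sup>2 = (x1 - y1)\<^sup>2 + (x2 - y2)\<^sup>2"
    by (simp add: xy norm_Pair)
  then show ?thesis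
    using assms square_diff_le_disp[of x1 \<alpha> s y1 a w] square_diff_le_disp[of x2 \<beta> t y2 b u]
      square_diff_le_disp[of x2 \<alpha> s y2 a w] square_diff_le_disp[of x1 \<beta> t y1 b u]
    by (cases v) (auto simp: rect_def xy)
qed

text \<open>The product plan: each point of the cell is spread uniformly over the target rectangle.
  Cells of side at most 1 keep the excess over \<open>disp\<close> bounded per point.\<close>

lemma transport_density_rect:
  assumes \<mu>: "sets \<mu> = sets borel" "finite_measure \<mu>"
    and cnt: "measure \<mu> (rect v {\<alpha>..<\<alpha> + s} {\<beta>..<\<beta> + t}) = real n"
    and st: "s \<le> 1" "t \<le> 1" and w: "0 \<le> w" "0 \<le> u" and \<rho>: "0 \<le> \<rho>" "\<rho> * (w * u) = real n"
  shows "\<exists>g. transport_density \<mu> \<rho> (rect v {\<alpha>..<\<alpha> + s} {\<beta>..<\<beta> + t}) (rect v {a..<a + w} {b..<b + u}) g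
    (ennreal (9 * (real n * (disp (\<alpha>, s, a, w) + disp (\<beta>, t, b, u))) + 6 * real n))"
proof -
  let ?M = "\<mu> \<Otimes>\<^sub>M (lborel :: plane measure)"
  interpret finite_measure \<mu> by fact
  note [measurable_cong] = \<mu>(1)
  define q R where "q = rect v {\<alpha>..<\<alpha> + s} {\<beta>..<\<beta> + t}" and "R = rect v {a..<a + w} {b..<b + u}"
  have [measurable]: "q \<in> sets borel" "R \<in> sets borel" by (auto simp: q_def R_def)
  have q: "emeasure \<mu> q = ennreal (real n)" using cnt by (simp add: q_def emeasure_eq_measure)
  have R: "emeasure lborel R = ennreal (w * u)" using w by (simp add: R_def emeasure_lborel_rect)
  have sets_M: "sets ?M = sets borel" by (rule sets_pair_plane[OF \<mu>(1)])
  show ?thesis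
  proof (cases "n = 0")
    \<comment> \<open>An empty cell has a target of zero mass, and the zero density serves as the
      plan.\<close>
    case True
    have "emeasure \<mu> (A \<inter> q) = 0" for A
      using q True emeasure_mono[of "A \<inter> q" q \<mu>] \<mu> by simp
    moreover have "ennreal \<rho> * emeasure lborel (A \<inter> R) = 0" for A
    proof -
      have "ennreal \<rho> * emeasure lborel (A \<inter> R) \<le> ennreal \<rho> * emeasure lborel R"
        by (intro mult_left_mono emeasure_mono) auto
      also have "\<dots> = 0" using True \<rho> w unfolding R by (simp flip: ennreal_mult)
      finally show ?thesis by simp
    qed
    ultimately show ?thesis
      by (intro exI[of _ "\<lambda>_. 0"]) (simp add: transport_density_def True flip: q_def R_def)
  next
    case False
    \<comment> \<open>This constant gives each point total mass c w u = 1, and the n points together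
      density \<open>\<rho>\<close> on the target.\<close>
    define c where "c = \<rho> / real n"
    have c: "0 \<le> c" "c * (w * u) = 1" "c * real n = \<rho>" using False \<rho> by (auto simp: c_def)
    define g where "g z = ennreal c * indicator (q \<times> R) z" for z
    have Times: "A \<times> B \<in> sets ?M" if "A \<in> sets borel" "B \<in> sets borel" for A B :: "plane set"
      using that by (auto simp: sets_M intro!: borel_Times)
    have em: "emeasure ?M (A \<times> B) = emeasure \<mu> A * emeasure lborel B" if "A \<in> sets borel" "B \<in> sets borel" for A B
      using that \<mu> by (intro lborel.emeasure_pair_measure_Times) auto
    have gm [measurable]: "g \<in> borel_measurable ?M"
      unfolding g_def by (intro borel_measurable_times_ennreal borel_measurable_const borel_measurable_indicator Times) auto
    have "(\<integral>\<^sup>+ z. g z * indicator (A \<times> UNIV) z \<partial>?M) = emeasure \<mu> (A \<inter> q)" if [measurable]: "A \<in> sets borel" for A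
    proof -
      have "(\<integral>\<^sup>+ z. g z * indicator (A \<times> UNIV) z \<partial>?M) = (\<integral>\<^sup>+ z. ennreal c * indicator ((A \<inter> q) \<times> R) z \<partial>?M)"
        by (intro nn_integral_cong) (auto simp: g_def split: split_indicator)
      also have "\<dots> = ennreal c * (emeasure \<mu> (A \<inter> q) * ennreal (w * u))"
        by (subst nn_integral_cmult_indicator) (auto intro!: Times simp: em R)
      also have "\<dots> = emeasure \<mu> (A \<inter> q) * ennreal (c * (w * u))"
        using c w by (subst ennreal_mult) (auto simp: ac_simps)
      finally show ?thesis using c by simp
    qed
    moreover have "(\<integral>\<^sup>+ z. g z * indicator (UNIV \<times> A) z \<partial>?M) = ennreal \<rho> * emeasure lborel (A \<inter> R)" if [measurable]: "A \<in> sets borel" for A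
    proof -
      have "(\<integral>\<^sup>+ z. g z * indicator (UNIV \<times> A) z \<partial>?M) = (\<integral>\<^sup>+ z. ennreal c * indicator (q \<times> (A \<inter> R)) z \<partial>?M)"
        by (intro nn_integral_cong) (auto simp: g_def split: split_indicator)
      also have "\<dots> = ennreal c * (ennreal (real n) * emeasure lborel (A \<inter> R))"
        by (subst nn_integral_cmult_indicator) (auto intro!: Times simp: em q)
      also have "\<dots> = ennreal (c * real n) * emeasure lborel (A \<inter> R)"
        using c by (subst ennreal_mult) (auto simp: ac_simps)
      finally show ?thesis using c by simp
    qed
    moreover have "(\<integral>\<^sup>+ z. g z * ennreal ((norm (fst z - snd z))\<^sup>2) \<partial>?M)
        \<le> ennreal (9 * (real n * (disp (\<alpha>, s, a, w) + disp (\<beta>, t, b, u))) + 6 * real n)"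
    proof -
      define D where "D = 9 * (disp (\<alpha>, s, a, w) + disp (\<beta>, t, b, u)) + 6"
      have D: "0 \<le> D" using disp_nonneg[of "(\<alpha>, s, a, w)"] disp_nonneg[of "(\<beta>, t, b, u)"] by (simp add: D_def)
      have "(\<integral>\<^sup>+ z. g z * ennreal ((norm (fst z - snd z))\<^sup>2) \<partial>?M) \<le> (\<integral>\<^sup>+ z. ennreal (c * D) * indicator (q \<times> R) z \<partial>?M)"
      proof (intro nn_integral_mono)
        fix z
        show "g z * ennreal ((norm (fst z - snd z))\<^sup>2) \<le> ennreal (c * D) * indicator (q \<times> R) z"
        proof (cases "z \<in> q \<times> R")
          case True
          then have "(norm (fst z - snd z))\<^sup>2 \<le> D"
            unfolding D_def q_def R_def using st by (intro square_norm_diff_le_disp) auto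
          then show ?thesis using True c D by (auto simp: g_def ennreal_mult intro!: mult_left_mono ennreal_leI)
        qed (simp add: g_def)
      qed
      also have "\<dots> = ennreal (c * D) * (ennreal (real n) * ennreal (w * u))"
        by (subst nn_integral_cmult_indicator) (auto intro!: Times simp: em q R)
      also have "\<dots> = ennreal (c * D * (real n * (w * u)))"
        using c D w by (simp add: ennreal_mult)
      also have "c * D * (real n * (w * u)) = D * real n * (c * (w * u))" by simp
      finally show ?thesis unfolding c by (simp add: D_def algebra_simps)
    qed
    ultimately show ?thesis
      unfolding transport_density_def q_def[symmetric] R_def[symmetric] using gm by blast
  qed
qed

text \<open>The plans of the two halves are glued. Cutting the target in the proportion p passes the
  balance between \<open>\<rho>\<close> times area and number of points on to both halves. The
  bounds on s and t say that d alternating bisections, starting with s, end in cells of sides at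
  most 1.\<close>

lemma transport_density_cells:
  assumes \<mu>: "sets \<mu> = sets borel" "finite_measure \<mu>"
    and cnt: "\<And>C. C \<in> sets borel \<Longrightarrow> measure \<mu> C = real (cnt C)"
    and "0 \<le> s" "0 \<le> t" "s \<le> 2 ^ (Suc d div 2)" "t \<le> 2 ^ (d div 2)"
    and "0 \<le> w" "0 \<le> u" and \<rho>: "0 \<le> \<rho>" and "\<rho> * (w * u) = real (sum_list (map cnt (cells d v (\<alpha>, s) (\<beta>, t))))"
  shows "\<exists>g. transport_density \<mu> \<rho> (rect v {\<alpha>..<\<alpha> + s} {\<beta>..<\<beta> + t}) (rect v {a..<a + w} {b..<b + u}) g
    (ennreal (9 * cost d (\<alpha>, s, a, w) (\<beta>, t, b, u) (map cnt (cells d v (\<alpha>, s) (\<beta>, t)))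
      + 6 * real (sum_list (map cnt (cells d v (\<alpha>, s) (\<beta>, t))))))"
  using assms(4-9,11)
proof (induction d arbitrary: v \<alpha> s \<beta> t a w b u)
  case 0
  then show ?case using \<mu> cnt \<rho> by (simp add: transport_density_rect)
next
  case (Suc d)
  define xs where "xs = map cnt (cells d (\<not> v) (\<beta>, t) (\<alpha>, s / 2))"
  define ys where "ys = map cnt (cells d (\<not> v) (\<beta>, t) (\<alpha> + s / 2, s / 2))"
  define n m where "n = sum_list xs" and "m = sum_list ys"
  define p where "p = real n / real (n + m)"
  have len: "length xs = 2 ^ d" by (simp add: xs_def)
  have xys: "map cnt (cells (Suc d) v (\<alpha>, s) (\<beta>, t)) = xs @ ys" by (simp add: xs_def ys_def)
  have tot: "\<rho> * (w * u) = real (n + m)" using Suc.prems unfolding xys by (simp add: n_def m_def)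
  have p: "0 \<le> p" "p \<le> 1" by (auto simp: p_def divide_simps)
  \<comment> \<open>If both halves are empty, the default value of division gives p = 0 and the
    identity persists.\<close>
  have pn: "p * real (n + m) = real n" by (auto simp: p_def)
  have "\<rho> * (u * (p * w)) = p * (\<rho> * (w * u))" by simp
  then have m1: "\<rho> * (u * (p * w)) = real n" by (simp only: tot pn)
  have "\<rho> * (u * ((1 - p) * w)) = \<rho> * (w * u) - p * (\<rho> * (w * u))" by (simp add: algebra_simps)
  then have m2: "\<rho> * (u * ((1 - p) * w)) = real m" by (simp only: tot pn)
  have half: "s / 2 \<le> 2 ^ (d div 2)" using Suc.prems(3) by simp
  have pos: "0 \<le> s / 2" "0 \<le> p * w" "0 \<le> (1 - p) * w" using Suc.prems p by auto
  obtain g where g: "transport_density \<mu> \<rho> (rect (\<not> v) {\<beta>..<\<beta> + t} {\<alpha>..<\<alpha> + s / 2}) (rect (\<not> v) {b..<b + u} {a..<a + p * w}) g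
     (ennreal (9 * cost d (\<beta>, t, b, u) (\<alpha>, s / 2, a, p * w) xs + 6 * real n))"
    using Suc.IH[OF Suc.prems(2) pos(1) Suc.prems(4) half Suc.prems(6) pos(2) m1[unfolded n_def xs_def]]
    unfolding xs_def n_def by blast
  obtain g' where g': "transport_density \<mu> \<rho> (rect (\<not> v) {\<beta>..<\<beta> + t} {\<alpha> + s / 2..<\<alpha> + s / 2 + s / 2})
     (rect (\<not> v) {b..<b + u} {a + p * w..<a + p * w + (1 - p) * w}) g'
     (ennreal (9 * cost d (\<beta>, t, b, u) (\<alpha> + s / 2, s / 2, a + p * w, (1 - p) * w) ys + 6 * real m))"
    using Suc.IH[OF Suc.prems(2) pos(1) Suc.prems(4) half Suc.prems(6) pos(3) m2[unfolded m_def ys_def]]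
    unfolding ys_def m_def by blast
  have pw: "0 \<le> p * w" "p * w \<le> w" using p Suc.prems by (auto simp: mult_left_le_one_le)
  have S: "{\<alpha>..<\<alpha> + s} = {\<alpha>..<\<alpha> + s / 2} \<union> {\<alpha> + s / 2..<\<alpha> + s / 2 + s / 2}"
    using interval_split[of "s / 2" s \<alpha>] Suc.prems by simp
  have T: "{a..<a + w} = {a..<a + p * w} \<union> {a + p * w..<a + p * w + (1 - p) * w}"
    using interval_split[OF pw, of a] by (simp add: algebra_simps)
  have plan: "transport_density \<mu> \<rho> (rect v {\<alpha>..<\<alpha> + s} {\<beta>..<\<beta> + t}) (rect v {a..<a + w} {b..<b + u}) (\<lambda>z. g z + g' z)
     (ennreal (9 * cost d (\<beta>, t, b, u) (\<alpha>, s / 2, a, p * w) xs + 6 * real n)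
      + ennreal (9 * cost d (\<beta>, t, b, u) (\<alpha> + s / 2, s / 2, a + p * w, (1 - p) * w) ys + 6 * real m))"
    unfolding S T rect_Un
    using g g' unfolding rect_flip
    by (intro transport_density_add \<mu> rect_borel rect_disjoint) auto
  have cost_eq: "cost (Suc d) (\<alpha>, s, a, w) (\<beta>, t, b, u) (xs @ ys)
      = cost d (\<beta>, t, b, u) (\<alpha>, s / 2, a, p * w) xs
        + cost d (\<beta>, t, b, u) (\<alpha> + s / 2, s / 2, a + p * w, (1 - p) * w) ys"
    by (simp add: len Let_def p_def n_def m_def)
  have total: "real (sum_list (xs @ ys)) = real n + real m"
    by (simp add: n_def m_def)
  have plus: "ennreal (9 * x + 6 * real n) + ennreal (9 * y + 6 * real m)
      = ennreal (9 * (x + y) + 6 * (real n + real m))" if "0 \<le> x" "0 \<le> y" for x y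
    using that by (subst ennreal_plus[symmetric]) (auto simp: algebra_simps)
  show ?case
    unfolding xys cost_eq total by (rule exI, rule plan[unfolded plus[OF cost_nonneg cost_nonneg]])
qed

section \<open>Poisson counts\<close>

text \<open>Rounding gives a natural number for every measure; on configurations, whose values are
  integers, it changes nothing.\<close>

definition num_points :: "plane measure \<Rightarrow> plane set \<Rightarrow> nat" where
  "num_points \<mu> C = nat \<lfloor>measure \<mu> C\<rfloor>"

lemma configuration_facts:
  assumes "\<mu> \<in> configurations S"
  shows "sets \<mu> = sets borel" "finite_measure \<mu>"
    and "C \<in> sets borel \<Longrightarrow> emeasure \<mu> C = of_nat (num_points \<mu> C)"
    and "C \<in> sets borel \<Longrightarrow> measure \<mu> C = real (num_points \<mu> C)"
proof -
  show s: "sets \<mu> = sets borel" using assms by (simp add: configurations_def)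
  have int: "\<exists>n :: nat. emeasure \<mu> A = of_nat n" if "A \<in> sets borel" for A
    using assms that by (simp add: configurations_def)
  from int[of UNIV] obtain n :: nat where "emeasure \<mu> UNIV = of_nat n" by auto
  moreover have "space \<mu> = UNIV" using sets_eq_imp_space_eq[OF s] by simp
  ultimately show "finite_measure \<mu>" by (intro finite_measureI) simp
  assume "C \<in> sets borel"
  from int[OF this] obtain n :: nat where n: "emeasure \<mu> C = of_nat n" by auto
  then have "measure \<mu> C = real n" by (simp add: measure_def ennreal_of_nat_eq_real_of_nat)
  with n show "emeasure \<mu> C = of_nat (num_points \<mu> C)" "measure \<mu> C = real (num_points \<mu> C)"
    by (simp_all add: num_points_def)
qed

lemma prod_nth_eq_prod_list: "(\<Prod>i<length xs. f (xs ! i)) = prod_list (map f xs)" for f :: "'a \<Rightarrow> 'b :: comm_monoid_mult"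
  by (induction xs) (simp_all add: prod.lessThan_Suc_shift del: prod.lessThan_Suc)

lemma pmf_replicate_pmf: "pmf (replicate_pmf (length xs) p) xs = prod_list (map (pmf p) xs)"
proof (induction xs)
  case (Cons x xs)
  have "replicate_pmf (Suc (length xs)) p = map_pmf (\<lambda>(x, xs). x # xs) (pair_pmf p (replicate_pmf (length xs) p))"
    by (simp add: pair_pmf_def map_bind_pmf)
  then have "pmf (replicate_pmf (Suc (length xs)) p) (x # xs)
      = pmf (map_pmf (\<lambda>(x, xs). x # xs) (pair_pmf p (replicate_pmf (length xs) p))) ((\<lambda>(x, xs). x # xs) (x, xs))"
    by simp
  also have "\<dots> = pmf p x * pmf (replicate_pmf (length xs) p) xs"
    by (subst pmf_map_inj') (auto simp: inj_on_def pmf_pair)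
  finally show ?case using Cons by simp
qed simp

lemma space_poisson_process_law:
  assumes "poisson_process_law S P"
  shows "space P = configurations S"
proof -
  have "sets P = sets (configuration_algebra S)" using assms by (simp add: poisson_process_law_def)
  then have "space P = space (configuration_algebra S)" by (rule sets_eq_imp_space_eq)
  also have "\<dots> = configurations S" unfolding configuration_algebra_def by (rule space_measure_of) auto
  finally show ?thesis .
qed

lemma measurable_emeasure_configuration:
  assumes "poisson_process_law S P" "A \<in> sets borel"
  shows "(\<lambda>\<mu>. emeasure \<mu> A) \<in> borel_measurable P"
proof (rule measurableI)
  fix B :: "ennreal set" assume "B \<in> sets borel"
  then have "(\<lambda>\<mu>. emeasure \<mu> A) -` B \<inter> configurations S \<in> sets (configuration_algebra S)"
    using assms(2) unfolding configuration_algebra_def by (intro in_measure_of) auto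
  then show "(\<lambda>\<mu>. emeasure \<mu> A) -` B \<inter> space P \<in> sets P"
    using assms(1) by (simp add: space_poisson_process_law[OF assms(1)] poisson_process_law_def)
qed simp

lemma measurable_counts:
  assumes P: "poisson_process_law S P" and Cs: "set Cs \<subseteq> sets borel"
  shows "(\<lambda>\<mu>. map (num_points \<mu>) Cs) \<in> measurable P (count_space UNIV)"
  using Cs
proof (induction Cs)
  case (Cons C Cs)
  have [measurable]: "(\<lambda>\<mu>. emeasure \<mu> C) \<in> borel_measurable P"
    using Cons.prems by (intro measurable_emeasure_configuration[OF P]) auto
  have [measurable]: "(\<lambda>\<mu>. num_points \<mu> C) \<in> measurable P (count_space UNIV)"
    unfolding num_points_def measure_def by measurable
  have Cs: "(\<lambda>\<mu>. map (num_points \<mu>) Cs) \<in> measurable P (count_space UNIV)" using Cons by simp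
  have "(\<lambda>\<mu>. (\<lambda>xs \<mu>. num_points \<mu> C # xs) (map (num_points \<mu>) Cs) \<mu>) \<in> measurable P (count_space UNIV)"
    by (rule measurable_compose_countable[OF _ Cs]) measurable
  then show ?case by simp
qed simp

text \<open>Lists of naturals are countable, so it suffices to compare point masses. These factor by
  independence on disjoint cells, each factor being a Poisson weight of mean 1.\<close>

lemma distr_counts:
  assumes P: "poisson_process_law S P" and Cs: "Cs \<noteq> []" "set Cs \<subseteq> sets borel" "\<Union> (set Cs) \<subseteq> S"
    and disj: "sorted_wrt (\<lambda>A B. A \<inter> B = {}) Cs" and unit: "\<And>C. C \<in> set Cs \<Longrightarrow> measure lborel C = 1"
  shows "distr P (count_space UNIV) (\<lambda>\<mu>. map (num_points \<mu>) Cs) = measure_pmf (replicate_pmf (length Cs) (poisson_pmf 1))"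
proof (rule measure_eqI_countable[of _ UNIV])
  interpret P: prob_space P using P by (simp add: poisson_process_law_def)
  let ?n = "length Cs"
  note counts [measurable] = measurable_counts[OF P Cs(2)]
  have space: "space P = configurations S" by (rule space_poisson_process_law[OF P])
  have law: "P.prob {\<mu> \<in> space P. emeasure \<mu> A = of_nat k} = exp (- measure lborel A) * measure lborel A ^ k / fact k"
    if "A \<in> sets borel" "A \<subseteq> S" for A k
    using P that by (simp add: poisson_process_law_def)
  fix xs :: "nat list"
  have "emeasure (distr P (count_space UNIV) (\<lambda>\<mu>. map (num_points \<mu>) Cs)) {xs}
      = emeasure P {\<mu> \<in> space P. map (num_points \<mu>) Cs = xs}"
    by (subst emeasure_distr) (auto intro!: arg_cong2[where f=emeasure])
  also have "\<dots> = ennreal (P.prob {\<mu> \<in> space P. map (num_points \<mu>) Cs = xs})"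
    by (rule P.emeasure_eq_measure)
  also have "P.prob {\<mu> \<in> space P. map (num_points \<mu>) Cs = xs} = pmf (replicate_pmf ?n (poisson_pmf 1)) xs"
  proof (cases "length xs = ?n")
    \<comment> \<open>Lists of the wrong length have probability zero on both sides.\<close>
    case False
    then have empty: "{\<mu> \<in> space P. map (num_points \<mu>) Cs = xs} = {}" by auto
    have "xs \<notin> set_pmf (replicate_pmf ?n (poisson_pmf 1))"
      using False by (simp add: set_replicate_pmf)
    then show ?thesis unfolding empty by (simp add: set_pmf_iff)
  next
    case True
    have borel: "Cs ! i \<in> sets borel" if "i < ?n" for i using that Cs by auto
    have disj_nth: "disjoint_family_on (\<lambda>i. Cs ! i) {..<?n}"
    proof (unfold disjoint_family_on_def, intro ballI impI)
      fix i j assume "i \<in> {..<?n}" "j \<in> {..<?n}" "i \<noteq> j"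
      then show "Cs ! i \<inter> Cs ! j = {}"
        using sorted_wrt_nth_less[OF disj, of i j] sorted_wrt_nth_less[OF disj, of j i]
        by (cases "i < j") auto
    qed
    have sub: "Cs ! i \<subseteq> S" if "i < ?n" for i using that Cs(3) nth_mem by blast
    have indep: "P.indep_vars (\<lambda>_. borel) (\<lambda>i \<mu>. emeasure \<mu> (Cs ! i)) {..<?n}"
      using P borel sub disj_nth unfolding poisson_process_law_def by blast
    have "map (num_points \<mu>) Cs = xs \<longleftrightarrow> (\<forall>i<?n. emeasure \<mu> (Cs ! i) = of_nat (xs ! i))" if "\<mu> \<in> space P" for \<mu>
      using True configuration_facts(3)[OF that[unfolded space] borel] by (simp add: list_eq_iff_nth_eq)
    then have "{\<mu> \<in> space P. map (num_points \<mu>) Cs = xs}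
        = (\<Inter>i\<in>{..<?n}. (\<lambda>\<mu>. emeasure \<mu> (Cs ! i)) -` {of_nat (xs ! i)} \<inter> space P)"
      using Cs(1) by auto
    also have "P.prob \<dots> = (\<Prod>i<?n. P.prob ((\<lambda>\<mu>. emeasure \<mu> (Cs ! i)) -` {of_nat (xs ! i)} \<inter> space P))"
      using Cs by (intro P.indep_varsD_finite[OF indep]) auto
    also have "\<dots> = (\<Prod>i<?n. pmf (poisson_pmf 1) (xs ! i))"
    proof (intro prod.cong refl)
      fix i assume i: "i \<in> {..<?n}"
      then have "P.prob {\<mu> \<in> space P. emeasure \<mu> (Cs ! i) = of_nat (xs ! i)}
          = exp (- measure lborel (Cs ! i)) * measure lborel (Cs ! i) ^ (xs ! i) / fact (xs ! i)"
        by (intro law borel sub) auto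
      moreover have "(\<lambda>\<mu>. emeasure \<mu> (Cs ! i)) -` {of_nat (xs ! i)} \<inter> space P
          = {\<mu> \<in> space P. emeasure \<mu> (Cs ! i) = of_nat (xs ! i)}" by auto
      ultimately show "P.prob ((\<lambda>\<mu>. emeasure \<mu> (Cs ! i)) -` {of_nat (xs ! i)} \<inter> space P) = pmf (poisson_pmf 1) (xs ! i)"
        using i unit by simp
    qed
    also have "\<dots> = pmf (replicate_pmf ?n (poisson_pmf 1)) xs"
      unfolding True[symmetric] pmf_replicate_pmf by (rule prod_nth_eq_prod_list)
    finally show ?thesis .
  qed
  finally show "emeasure (distr P (count_space UNIV) (\<lambda>\<mu>. map (num_points \<mu>) Cs)) {xs}
      = emeasure (measure_pmf (replicate_pmf ?n (poisson_pmf 1))) {xs}"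
    by (simp add: emeasure_pmf_single)
qed auto

section \<open>Exponential moment of the cost on a dyadic square\<close>

text \<open>The identity map of the side: the initial displacement is zero.\<close>

definition square_side :: "nat \<Rightarrow> interval_pair" where
  "square_side k = (- (2 ^ k) / 2, 2 ^ k, - (2 ^ k) / 2, 2 ^ k)"

definition square_cells :: "nat \<Rightarrow> plane set list" where
  "square_cells k = cells (2 * k) True (- (2 ^ k) / 2, 2 ^ k) (- (2 ^ k) / 2, 2 ^ k)"

text \<open>The cost of the glued plan per unit area, an upper bound for the squared Wasserstein
  distance over \<open>4 ^ k\<close>.\<close>

definition normalized_cost :: "nat \<Rightarrow> nat list \<Rightarrow> real" where
  "normalized_cost k xs = (9 * cost (2 * k) (square_side k) (square_side k) xs + 6 * real (sum_list xs)) / 4 ^ k"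

lemma Q_eq_rect: "Q (2 ^ k) = rect True {- (2 ^ k) / 2..<- (2 ^ k) / 2 + 2 ^ k} {- (2 ^ k) / 2..<- (2 ^ k) / 2 + 2 ^ k}"
  by (simp add: Q_def rect_def)

lemma Union_square_cells: "\<Union> (set (square_cells k)) = Q (2 ^ k)"
  unfolding square_cells_def Q_eq_rect by (rule Union_cells) auto

lemma Q_borel [measurable]: "Q l \<in> sets borel"
  by (auto simp: Q_def intro!: borel_Times)

lemma normalized_cost_nonneg: "0 \<le> normalized_cost k xs"
  by (simp add: normalized_cost_def cost_nonneg)

lemma real_sum_list: "real (sum_list xs) = sum_list (map real xs)"
  by (induction xs) auto

lemma W2_sq_le_normalized_cost:
  assumes "\<mu> \<in> configurations S"
  shows "W2_sq (restr \<mu> (Q (2 ^ k))) (uniform_on (measure \<mu> (Q (2 ^ k)) / (2 ^ k)\<^sup>2) (Q (2 ^ k)))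
    \<le> ennreal (4 ^ k * normalized_cost k (map (num_points \<mu>) (square_cells k)))"
proof -
  let ?l = "2 ^ k :: real" and ?xs = "map (num_points \<mu>) (square_cells k)"
  define \<rho> where "\<rho> = measure \<mu> (Q ?l) / ?l\<^sup>2"
  note \<mu> = configuration_facts[OF assms]
  have "map (measure \<mu>) (square_cells k) = map real ?xs"
    using \<mu>(4) cells_borel unfolding square_cells_def by auto
  then have "real (sum_list ?xs) = sum_list (map (measure \<mu>) (square_cells k))"
    by (simp only: real_sum_list)
  also have "\<dots> = measure \<mu> (Q ?l)"
    unfolding square_cells_def Q_eq_rect by (rule sum_list_measure_cells[OF \<mu>(2,1)]) auto
  finally have total: "\<rho> * (?l * ?l) = real (sum_list ?xs)" by (simp add: \<rho>_def power2_eq_square)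
  have \<rho>: "0 \<le> \<rho>" by (simp add: \<rho>_def)
  have "\<exists>g. transport_density \<mu> \<rho> (Q ?l) (Q ?l) g
    (ennreal (9 * cost (2 * k) (square_side k) (square_side k) ?xs + 6 * real (sum_list ?xs)))"
    unfolding Q_eq_rect square_side_def square_cells_def
    by (rule transport_density_cells) (use \<mu> \<rho> total in \<open>auto simp: square_cells_def\<close>)
  then obtain g where "transport_density \<mu> \<rho> (Q ?l) (Q ?l) g
    (ennreal (9 * cost (2 * k) (square_side k) (square_side k) ?xs + 6 * real (sum_list ?xs)))" ..
  from W2_sq_le_transport_density[OF this \<mu>(1,2) _ _ \<rho>] show ?thesis
    by (simp add: \<rho>_def normalized_cost_def)
qed

lemma suminf_poisson_weight:
  assumes "0 \<le> m"
  shows "(\<Sum>N. ennreal (poisson_weight m N * exp (\<theta> * real N))) = ennreal (exp (m * (exp \<theta> - 1)))"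
proof (rule suminf_ennreal_eq)
  have "(\<lambda>N. exp (- m) * ((m * exp \<theta>) ^ N /\<^sub>R fact N)) sums (exp (- m) * exp (m * exp \<theta>))"
    by (intro sums_mult exp_converges)
  moreover have "exp (- m) * ((m * exp \<theta>) ^ N /\<^sub>R fact N) = poisson_weight m N * exp (\<theta> * real N)" for N
    by (simp add: poisson_weight_def power_mult_distrib exp_of_nat2_mult divide_inverse)
  moreover have "exp (- m) * exp (m * exp \<theta>) = exp (m * (exp \<theta> - 1))"
    by (simp add: mult_exp_exp algebra_simps)
  ultimately show "(\<lambda>N. poisson_weight m N * exp (\<theta> * real N)) sums exp (m * (exp \<theta> - 1))"
    by simp
qed (use assms in \<open>simp add: poisson_weight_nonneg\<close>)

text \<open>The integral is sliced by the number N of points. On each slice the bisection bound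
  applies, and the term proportional to N is summed by the moment generating function of the Poisson
  law.\<close>

lemma nn_integral_exp_normalized_cost_le:
  "(\<integral>\<^sup>+ xs. ennreal (exp (normalized_cost k xs / 54)) \<partial>measure_pmf (replicate_pmf (4 ^ k) (poisson_pmf 1)))
    \<le> ennreal (exp (real k + 1))"
proof -
  let ?R = "measure_pmf (replicate_pmf (4 ^ k) (poisson_pmf 1))"
  \<comment> \<open>This l is the largest with 3 l (s^2 + s'^2) <= 1 for s = s' =
    \<open>2 ^ k\<close>. It fixes 54 = 9 times 6, and 6/54 = 1/9 gives
    \<open>\<theta>\<close>.\<close>
  define l \<theta> :: real where "l = 1 / (6 * 4 ^ k)" and "\<theta> = 1 / (9 * 4 ^ k)"
  define V where "V xs = cost (2 * k) (square_side k) (square_side k) xs" for xs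
  have pow: "(2 :: real) ^ k * 2 ^ k = 4 ^ k" by (simp flip: power_mult_distrib)
  have pow': "(2 :: nat) ^ (2 * k) = 4 ^ k" "(2 :: real) ^ (2 * k) = 4 ^ k" by (simp_all add: power_mult)
  have factor: "ennreal (exp (normalized_cost k xs / 54)) = ennreal (exp (l * V xs)) * ennreal (exp (\<theta> * real (sum_list xs)))" for xs
    by (simp add: normalized_cost_def V_def l_def \<theta>_def field_simps flip: ennreal_mult exp_add)
  have slices: "ennreal (exp (normalized_cost k xs / 54))
      = (\<Sum>N. ennreal (exp (\<theta> * real N)) * (ennreal (exp (l * V xs)) * indicator {xs. sum_list xs = N} xs))" for xs
  proof -
    have "(\<Sum>N. ennreal (exp (\<theta> * real N)) * (ennreal (exp (l * V xs)) * indicator {xs. sum_list xs = N} xs))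
        = (\<Sum>N\<in>{sum_list xs}. ennreal (exp (\<theta> * real N)) * (ennreal (exp (l * V xs)) * indicator {xs. sum_list xs = N} xs))"
      by (rule suminf_finite) auto
    then show ?thesis by (simp add: factor mult.commute)
  qed
  \<comment> \<open>The displacement starts at zero, so only the conserved weight remains: l times
    depth 2 k times 3 \<open>4 ^ k\<close> equals k.\<close>
  have slice: "(\<integral>\<^sup>+ xs. ennreal (exp (l * V xs)) * indicator {xs. sum_list xs = N} xs \<partial>?R)
      \<le> ennreal (poisson_weight (4 ^ k) N * exp (real k))" for N
    using nn_integral_exp_cost_le[where d="2 * k" and l=l and N=N and s="2 ^ k" and s'="2 ^ k" and w="2 ^ k" and w'="2 ^ k"
        and \<alpha>="- (2 ^ k) / 2" and \<alpha>'="- (2 ^ k) / 2" and a="- (2 ^ k) / 2" and a'="- (2 ^ k) / 2"]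
    by (simp add: V_def square_side_def disp.simps l_def pow' power2_eq_square pow)
  have "(\<integral>\<^sup>+ xs. ennreal (exp (normalized_cost k xs / 54)) \<partial>?R)
      = (\<Sum>N. ennreal (exp (\<theta> * real N)) * (\<integral>\<^sup>+ xs. ennreal (exp (l * V xs)) * indicator {xs. sum_list xs = N} xs \<partial>?R))"
    unfolding slices by (simp add: nn_integral_suminf nn_integral_cmult)
  also have "\<dots> \<le> (\<Sum>N. ennreal (exp (\<theta> * real N)) * ennreal (poisson_weight (4 ^ k) N * exp (real k)))"
    by (intro suminf_le mult_left_mono slice) auto
  also have "\<dots> = (\<Sum>N. ennreal (exp (real k)) * ennreal (poisson_weight (4 ^ k) N * exp (\<theta> * real N)))"
    by (intro suminf_cong) (simp add: poisson_weight_nonneg mult_ac flip: ennreal_mult)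
  also have "\<dots> = ennreal (exp (real k)) * ennreal (exp (4 ^ k * (exp \<theta> - 1)))"
    by (simp add: suminf_poisson_weight)
  also have "\<dots> = ennreal (exp (real k + 4 ^ k * (exp \<theta> - 1)))"
    by (simp add: exp_add ennreal_mult)
  also have "\<dots> \<le> ennreal (exp (real k + 1))"
  proof -
    have "1 \<le> (4 :: real) ^ k" by simp
    then have "2 \<le> 9 * (4 :: real) ^ k" by linarith
    then have "0 \<le> \<theta>" "\<theta> \<le> 1/2" by (auto simp: \<theta>_def divide_simps)
    then have "exp \<theta> \<le> 1 + 2 * \<theta>" using exp_bound_lemma[of \<theta>] by simp
    then have "4 ^ k * (exp \<theta> - 1) \<le> 4 ^ k * (2 * \<theta>)" by (intro mult_left_mono) auto
    then have "4 ^ k * (exp \<theta> - 1) \<le> 1" by (simp add: \<theta>_def)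
    then show ?thesis by (simp add: ennreal_leI)
  qed
  finally show ?thesis .
qed

lemma Q_mono: "l \<le> L \<Longrightarrow> Q l \<subseteq> Q L"
  by (auto simp: Q_def)

lemma poisson_exp_normalized_cost_le:
  assumes P: "poisson_process_law (Q (2 ^ K)) P" and "k \<le> K"
  shows "(\<integral>\<^sup>+ \<mu>. ennreal (exp (normalized_cost k (map (num_points \<mu>) (square_cells k)) / 54)) \<partial>P)
    \<le> ennreal (exp (real k + 1))"
proof -
  have len: "length (square_cells k) = 4 ^ k" by (simp add: square_cells_def power_mult)
  have borel: "set (square_cells k) \<subseteq> sets borel" using cells_borel by (auto simp: square_cells_def)
  have "distr P (count_space UNIV) (\<lambda>\<mu>. map (num_points \<mu>) (square_cells k)) = measure_pmf (replicate_pmf (4 ^ k) (poisson_pmf 1))"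
    unfolding len[symmetric]
  proof (rule distr_counts[OF P _ borel])
    show "square_cells k \<noteq> []" using len by auto
    show "\<Union> (set (square_cells k)) \<subseteq> Q (2 ^ K)"
      unfolding Union_square_cells using assms by (intro Q_mono) simp
    show "sorted_wrt (\<lambda>A B. A \<inter> B = {}) (square_cells k)"
      unfolding square_cells_def by (rule cells_disjoint) auto
    show "measure lborel C = 1" if "C \<in> set (square_cells k)" for C
      using emeasure_lborel_cells[OF _ _ that[unfolded square_cells_def]]
      by (simp add: measure_def power_mult power_mult_distrib[symmetric])
  qed
  then have "(\<integral>\<^sup>+ \<mu>. ennreal (exp (normalized_cost k (map (num_points \<mu>) (square_cells k)) / 54)) \<partial>P)
      = (\<integral>\<^sup>+ xs. ennreal (exp (normalized_cost k xs / 54)) \<partial>measure_pmf (replicate_pmf (4 ^ k) (poisson_pmf 1)))"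
    using nn_integral_distr[OF measurable_counts[OF P borel], of "\<lambda>xs. ennreal (exp (normalized_cost k xs / 54))"] by simp
  then show ?thesis using nn_integral_exp_normalized_cost_le[of k] by simp
qed

section \<open>The random radius\<close>

text \<open>The numerator of the derivative is x (2 ln (2 x) - 1), positive on x >= 1 because ln 2
  >= 2/3.\<close>

lemma ratio_square_log_strict_mono:
  fixes r r' :: real
  assumes "1 \<le> r" "r < r'"
  shows "r\<^sup>2 / ln (2 * r) < r'\<^sup>2 / ln (2 * r')"
proof (rule DERIV_pos_imp_increasing[OF assms(2)])
  fix x assume x: "r \<le> x" "x \<le> r'"
  have "ln 2 \<le> ln (2 * x)" using x assms by simp
  then have l: "2/3 \<le> ln (2 * x)" using ln2_ge_two_thirds by linarith
  have "0 < x * (2 * ln (2 * x) - 1)" using l x assms by simp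
  then have "0 < (2 * x * ln (2 * x) - x) / (ln (2 * x))\<^sup>2"
    using l by (simp add: algebra_simps)
  moreover have "((\<lambda>r. r\<^sup>2 / ln (2 * r)) has_real_derivative (2 * x * ln (2 * x) - x) / (ln (2 * x))\<^sup>2) (at x)"
    using l x assms by (auto intro!: derivative_eq_intros simp: field_simps power2_eq_square)
  ultimately show "\<exists>y. ((\<lambda>r. r\<^sup>2 / ln (2 * r)) has_real_derivative y) (at x) \<and> 0 < y" by blast
qed

text \<open>Intermediate values give a solution, and strict monotonicity makes it monotone in M,
  hence Borel. Clamping M at 1/ln 2, the value of the ratio at 1, makes the inverse total.\<close>

lemma inverse_ratio_square_log:
  obtains \<psi> :: "real \<Rightarrow> real" where "mono \<psi>" "\<And>M. 1 \<le> \<psi> M"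
    and "\<And>M. 1 / ln 2 \<le> M \<Longrightarrow> (\<psi> M)\<^sup>2 / ln (2 * \<psi> M) = M"
proof -
  let ?\<phi> = "\<lambda>r :: real. r\<^sup>2 / ln (2 * r)"
  have "\<exists>r\<ge>1. ?\<phi> r = max M (1 / ln 2)" for M
  proof -
    \<comment> \<open>Since ln (2 b) <= 2 b, the ratio at b is at least b/2, which is the value to
      be reached.\<close>
    define b where "b = 2 * max M (1 / ln 2)"
    have ln2: "0 < ln (2 :: real)" "ln (2 :: real) \<le> 1" using ln_le_minus_one[of 2] by auto
    have "1 \<le> 1 / ln (2 :: real)" using ln2 by simp
    moreover have "1 / ln 2 \<le> max M (1 / ln 2)" by simp
    ultimately have b: "1 \<le> b" unfolding b_def by linarith
    have "0 < ln (2 * b)" using b by simp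
    moreover have "ln (2 * b) \<le> 2 * b" using ln_le_minus_one[of "2 * b"] b by simp
    ultimately have "b\<^sup>2 / (2 * b) \<le> ?\<phi> b" using b by (intro divide_left_mono) auto
    then have top: "max M (1 / ln 2) \<le> ?\<phi> b" using b by (simp add: power2_eq_square b_def)
    have cont: "continuous_on {1..b} ?\<phi>"
      by (intro continuous_intros) (auto simp: ln_eq_zero_iff)
    have "?\<phi> 1 \<le> max M (1 / ln 2)" by simp
    from IVT'[of ?\<phi> 1 "max M (1 / ln 2)" b, OF this top b cont] show ?thesis by auto
  qed
  then obtain \<psi> where \<psi>: "\<And>M. 1 \<le> \<psi> M" "\<And>M. ?\<phi> (\<psi> M) = max M (1 / ln 2)" by metis
  have "mono \<psi>"
  proof (rule monoI, rule ccontr)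
    fix M M' :: real assume M: "M \<le> M'" "\<not> \<psi> M \<le> \<psi> M'"
    then have "?\<phi> (\<psi> M') < ?\<phi> (\<psi> M)" by (intro ratio_square_log_strict_mono \<psi>) auto
    moreover have "max M (1 / ln 2) \<le> max M' (1 / ln 2)" using M(1) by (intro max.mono) auto
    ultimately show False unfolding \<psi> by linarith
  qed
  with \<psi> show ?thesis by (intro that) (auto simp: max_def)
qed

section \<open>The maximum over scales and its exponential moment\<close>

text \<open>The starting value ln 2 becomes 1/ln 2 after division by (ln 2)^2, the least value for
  which the equation for the radius has a solution r >= 1. Scale 0 is left out; the side l >= 2 r >=
  2 never reaches it.\<close>

fun worst_ratio :: "nat \<Rightarrow> (nat \<Rightarrow> real) \<Rightarrow> real" where
  "worst_ratio 0 z = ln 2"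
| "worst_ratio (Suc K) z = max (worst_ratio K z) (z (Suc K) / real (Suc K))"

lemma worst_ratio_ge: "ln 2 \<le> worst_ratio K z"
  by (induction K) auto

lemma ratio_le_worst_ratio: "1 \<le> k \<Longrightarrow> k \<le> K \<Longrightarrow> z k / real k \<le> worst_ratio K z"
proof (induction K)
  case (Suc K)
  then show ?case by (cases "k = Suc K") auto
qed simp

text \<open>A union bound in exponential form. The weights exp(-2 k) beat the moments exp(k + 1) of
  the single scales, so the sum stays bounded uniformly in K.\<close>

lemma exp_worst_ratio_le:
  "exp (worst_ratio K z / 54) \<le> exp 2 * (1 + (\<Sum>k<K. exp (z (Suc k) / 54 - 2 * real (Suc k))))"
proof (induction K)
  case 0
  have "ln 2 / 54 \<le> (2 :: real)" using ln_le_minus_one[of 2] by simp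
  then show ?case by simp
next
  case (Suc K)
  let ?S = "\<Sum>k<K. exp (z (Suc k) / 54 - 2 * real (Suc k))"
  have S: "0 \<le> ?S" by (intro sum_nonneg) auto
  define y where "y = z (Suc K) / real (Suc K) / 54"
  have z: "z (Suc K) / 54 = real (Suc K) * y" by (simp add: y_def del: of_nat_Suc)
  have "exp y \<le> exp 2 * (1 + exp (z (Suc K) / 54 - 2 * real (Suc K)))"
  proof (cases "y \<le> 2")
    case True
    then have "exp y \<le> exp 2 * 1" by simp
    also have "\<dots> \<le> exp 2 * (1 + exp (z (Suc K) / 54 - 2 * real (Suc K)))"
      by (intro mult_left_mono) auto
    finally show ?thesis .
  next
    case False
    \<comment> \<open>Above the threshold 2, replacing y - 2 by \<open>Suc K\<close> times it only
      increases it, and this produces the weight of the scale.\<close>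
    then have "1 * (y - 2) \<le> real (Suc K) * (y - 2)" by (intro mult_right_mono) auto
    then have "y \<le> 2 + (z (Suc K) / 54 - 2 * real (Suc K))" unfolding z by (simp add: algebra_simps)
    then have "exp y \<le> exp 2 * exp (z (Suc K) / 54 - 2 * real (Suc K))" by (simp flip: exp_add)
    also have "\<dots> \<le> exp 2 * (1 + exp (z (Suc K) / 54 - 2 * real (Suc K)))"
      by (intro mult_left_mono) auto
    finally show ?thesis .
  qed
  also have "\<dots> \<le> exp 2 * (1 + (?S + exp (z (Suc K) / 54 - 2 * real (Suc K))))"
    using S by (intro mult_left_mono) auto
  finally have new: "exp y \<le> exp 2 * (1 + (?S + exp (z (Suc K) / 54 - 2 * real (Suc K))))" .
  have "exp 2 * (1 + ?S) \<le> exp 2 * (1 + (?S + exp (z (Suc K) / 54 - 2 * real (Suc K))))"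
    by (intro mult_left_mono) auto
  with Suc.IH have old: "exp (worst_ratio K z / 54) \<le> exp 2 * (1 + (?S + exp (z (Suc K) / 54 - 2 * real (Suc K))))"
    by linarith
  have "worst_ratio (Suc K) z / 54 = worst_ratio K z / 54 \<or> worst_ratio (Suc K) z / 54 = y"
    by (auto simp: y_def max_def simp del: of_nat_Suc)
  then show ?case unfolding sum.lessThan_Suc using old new by (elim disjE) (simp_all only:)
qed

definition cost_ratio :: "plane measure \<Rightarrow> nat \<Rightarrow> real" where
  "cost_ratio \<mu> k = normalized_cost k (map (num_points \<mu>) (square_cells k))"

lemma cost_ratio_measurable:
  assumes "poisson_process_law S P"
  shows "(\<lambda>\<mu>. cost_ratio \<mu> k) \<in> borel_measurable P"
proof -
  have "set (square_cells k) \<subseteq> sets borel" using cells_borel by (auto simp: square_cells_def)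
  from measurable_counts[OF assms this] show ?thesis
    unfolding cost_ratio_def by (rule measurable_compose) simp
qed

lemma worst_ratio_measurable:
  assumes "poisson_process_law S P"
  shows "(\<lambda>\<mu>. worst_ratio K (cost_ratio \<mu>)) \<in> borel_measurable P"
  by (induction K) (auto intro!: borel_measurable_max borel_measurable_divide cost_ratio_measurable[OF assms])

lemma nn_integral_exp_worst_ratio_le:
  assumes P: "poisson_process_law (Q (2 ^ K)) P"
  shows "(\<integral>\<^sup>+ \<mu>. ennreal (exp (worst_ratio K (cost_ratio \<mu>) / 54)) \<partial>P) \<le> ennreal (3 * exp 2)"
proof -
  interpret P: prob_space P using P by (simp add: poisson_process_law_def)
  note [measurable] = cost_ratio_measurable[OF P]
  have moment: "(\<integral>\<^sup>+ \<mu>. ennreal (exp (cost_ratio \<mu> (Suc k) / 54 - 2 * real (Suc k))) \<partial>P) \<le> ennreal ((1/2) ^ k)"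
    if "k < K" for k
  proof -
    have "(\<integral>\<^sup>+ \<mu>. ennreal (exp (cost_ratio \<mu> (Suc k) / 54 - 2 * real (Suc k))) \<partial>P)
        = (\<integral>\<^sup>+ \<mu>. ennreal (exp (- (2 * real (Suc k)))) * ennreal (exp (cost_ratio \<mu> (Suc k) / 54)) \<partial>P)"
      by (intro nn_integral_cong) (simp flip: ennreal_mult exp_add)
    also have "\<dots> = ennreal (exp (- (2 * real (Suc k)))) * (\<integral>\<^sup>+ \<mu>. ennreal (exp (cost_ratio \<mu> (Suc k) / 54)) \<partial>P)"
      by (intro nn_integral_cmult) measurable
    also have "\<dots> \<le> ennreal (exp (- (2 * real (Suc k)))) * ennreal (exp (real (Suc k) + 1))"
      unfolding cost_ratio_def using that by (intro mult_left_mono poisson_exp_normalized_cost_le[OF P]) auto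
    \<comment> \<open>With the index shifted by one, -2 (k + 1) + (k + 2) = -k.\<close>
    also have "\<dots> = ennreal (exp (- 1) ^ k)"
      by (simp add: exp_of_nat_mult[symmetric] flip: ennreal_mult exp_add)
    also have "\<dots> \<le> ennreal ((1/2) ^ k)"
    proof (intro ennreal_leI power_mono)
      have "2 \<le> exp (1 :: real)" using exp_ge_add_one_self[of 1] by simp
      then show "exp (- 1 :: real) \<le> 1/2" by (simp add: exp_minus divide_simps)
    qed simp
    finally show ?thesis .
  qed
  have geo: "(\<Sum>k<K. (1/2 :: real) ^ k) \<le> 2"
  proof -
    have "(\<Sum>k<K. (1/2 :: real) ^ k) = 2 - 2 * (1/2) ^ K" for K by (induction K) auto
    then show ?thesis by simp
  qed
  have "(\<integral>\<^sup>+ \<mu>. ennreal (exp (worst_ratio K (cost_ratio \<mu>) / 54)) \<partial>P)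
      \<le> (\<integral>\<^sup>+ \<mu>. ennreal (exp 2) * (1 + (\<Sum>k<K. ennreal (exp (cost_ratio \<mu> (Suc k) / 54 - 2 * real (Suc k))))) \<partial>P)"
  proof (intro nn_integral_mono)
    fix \<mu>
    let ?S = "\<Sum>k<K. exp (cost_ratio \<mu> (Suc k) / 54 - 2 * real (Suc k))"
    have S: "0 \<le> ?S" by (intro sum_nonneg) auto
    have "ennreal (exp (worst_ratio K (cost_ratio \<mu>) / 54)) \<le> ennreal (exp 2 * (1 + ?S))"
      by (intro ennreal_leI exp_worst_ratio_le)
    also have "\<dots> = ennreal (exp 2) * (1 + ennreal ?S)"
      using S by (simp add: ennreal_mult)
    finally show "ennreal (exp (worst_ratio K (cost_ratio \<mu>) / 54))
        \<le> ennreal (exp 2) * (1 + (\<Sum>k<K. ennreal (exp (cost_ratio \<mu> (Suc k) / 54 - 2 * real (Suc k)))))"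
      by simp
  qed
  also have "\<dots> = ennreal (exp 2) * (1 + (\<Sum>k<K. \<integral>\<^sup>+ \<mu>. ennreal (exp (cost_ratio \<mu> (Suc k) / 54 - 2 * real (Suc k))) \<partial>P))"
    by (simp add: nn_integral_cmult nn_integral_add nn_integral_sum P.emeasure_space_1 del: sum_ennreal)
  also have "\<dots> \<le> ennreal (exp 2) * (1 + (\<Sum>k<K. ennreal ((1/2) ^ k)))"
    by (intro mult_left_mono add_left_mono sum_mono moment) auto
  also have "\<dots> = ennreal (exp 2 * (1 + (\<Sum>k<K. (1/2) ^ k)))"
    by (simp add: ennreal_mult sum_nonneg del: power_one_over)
  also have "\<dots> \<le> ennreal (exp 2 * 3)"
    using geo by (intro ennreal_leI mult_left_mono) auto
  finally show ?thesis by (simp add: mult.commute)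
qed

text \<open>With x = ln (\<open>2 ^ k\<close>) and \<open>\<rho>\<close> = ln r, the product of
  \<open>\<rho>\<close> >= 0 and x - \<open>\<rho>\<close> - ln 2 >= 0 expands to ln 2 x <= (x -
  \<open>\<rho>\<close>) ln (2 r). The factor (ln 2)^2 in the equation for r supplies one ln 2 to
  turn k into x and one for the left side here.\<close>

lemma ratio_le_ln_over_square:
  fixes M r z :: real
  assumes r: "1 \<le> r" "r\<^sup>2 / ln (2 * r) = M / (ln 2)\<^sup>2" and z: "z \<le> M * real k" and l: "2 * r \<le> 2 ^ k"
  shows "z / 4 ^ k \<le> ln (2 ^ k / r) / (2 ^ k / r)\<^sup>2"
proof -
  define x \<rho> where "x = real k * ln 2" and "\<rho> = ln r"
  have pos: "0 < ln (2 :: real)" "0 < ln (2 * r)" using r by auto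
  have x: "ln (2 ^ k) = x" by (simp add: x_def ln_realpow)
  have "ln (2 * r) \<le> ln (2 ^ k)" using l r by (subst ln_le_cancel_iff) auto
  moreover have lnr: "ln (2 * r) = ln 2 + \<rho>" using r by (simp add: \<rho>_def ln_mult)
  ultimately have "0 \<le> \<rho> * (x - \<rho> - ln 2)" using r x by (intro mult_nonneg_nonneg) (auto simp: \<rho>_def)
  then have key: "ln 2 * x \<le> (x - \<rho>) * ln (2 * r)" unfolding lnr by (simp add: algebra_simps)
  have r2: "M = r\<^sup>2 * (ln 2)\<^sup>2 / ln (2 * r)" using r(2) pos by (simp add: field_simps)
  have "z \<le> r\<^sup>2 * (ln 2 * x) / ln (2 * r)"
    using z unfolding r2 by (simp add: x_def power2_eq_square algebra_simps)
  also have "\<dots> \<le> r\<^sup>2 * ((x - \<rho>) * ln (2 * r)) / ln (2 * r)"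
    using pos by (intro divide_right_mono mult_left_mono key) auto
  also have "\<dots> = r\<^sup>2 * ln (2 ^ k / r)"
    using pos r by (simp add: ln_div x \<rho>_def)
  finally have "z / 4 ^ k \<le> r\<^sup>2 * ln (2 ^ k / r) / 4 ^ k" by (intro divide_right_mono) auto
  also have "(4 :: real) ^ k = (2 ^ k)\<^sup>2" by (simp add: power2_eq_square flip: power_mult_distrib)
  finally show ?thesis by (simp add: power_divide \<open>(4 :: real) ^ k = (2 ^ k)\<^sup>2\<close> mult.commute)
qed

theorem theorem1p3:
  "\<exists>c > 0 :: real. \<forall>P :: real \<Rightarrow> plane measure measure.
     (\<forall>L \<in> dyadic. poisson_process_law (Q L) (P L)) \<longrightarrow>
     (\<exists>r :: real \<Rightarrow> plane measure \<Rightarrow> real.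
        (\<forall>L \<in> dyadic. r L \<in> borel_measurable (P L) \<and> (\<forall>\<mu> \<in> space (P L). 1 \<le> r L \<mu>)) \<and>
        (SUP L \<in> dyadic. \<integral>\<^sup>+ \<mu>. ennreal (exp (c * (r L \<mu>)\<^sup>2 / ln (2 * r L \<mu>))) \<partial>P L) < \<infinity> \<and>
        (\<forall>L \<in> dyadic. \<forall>\<mu> \<in> space (P L). \<forall>l \<in> dyadic. 2 * r L \<mu> \<le> l \<and> l \<le> L \<longrightarrow>
           W2_sq (restr \<mu> (Q l)) (uniform_on (measure \<mu> (Q l) / l\<^sup>2) (Q l)) / ennreal (l ^ 4)
             \<le> ennreal (ln (l / r L \<mu>) / (l / r L \<mu>)\<^sup>2)))"

\<comment> \<open>By the equation for r, this c turns the exponent into M/54, the exponent for which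
  the moment is bounded.\<close>
proof (intro exI[of _ "(ln 2)\<^sup>2 / 54"] conjI allI impI)
  show "0 < (ln 2)\<^sup>2 / (54 :: real)" by simp
  fix P :: "real \<Rightarrow> plane measure measure"
  assume P: "\<forall>L \<in> dyadic. poisson_process_law (Q L) (P L)"
  obtain \<psi> :: "real \<Rightarrow> real" where \<psi>: "mono \<psi>" "\<And>M. 1 \<le> \<psi> M"
    "\<And>M. 1 / ln 2 \<le> M \<Longrightarrow> (\<psi> M)\<^sup>2 / ln (2 * \<psi> M) = M"
    by (rule inverse_ratio_square_log) blast
  \<comment> \<open>The rounded logarithm recovers K from L = \<open>2 ^ K\<close>.\<close>
  define M where "M L \<mu> = worst_ratio (nat \<lfloor>log 2 L\<rfloor>) (cost_ratio \<mu>)" for L \<mu>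
  define r where "r L \<mu> = \<psi> (M L \<mu> / (ln 2)\<^sup>2)" for L \<mu>
  have M_pow: "M (2 ^ K) \<mu> = worst_ratio K (cost_ratio \<mu>)" for K \<mu>
    by (simp add: M_def log_nat_power)
  have P_pow: "poisson_process_law (Q (2 ^ K)) (P (2 ^ K))" for K
    using P by (auto simp: dyadic_def)
  have r_eq: "(r L \<mu>)\<^sup>2 / ln (2 * r L \<mu>) = M L \<mu> / (ln 2)\<^sup>2" for L \<mu>
  proof -
    have "ln 2 / (ln 2)\<^sup>2 \<le> M L \<mu> / (ln 2)\<^sup>2"
      unfolding M_def by (intro divide_right_mono worst_ratio_ge) auto
    then show ?thesis unfolding r_def by (intro \<psi>(3)) (simp add: power2_eq_square)
  qed
  show "\<exists>r :: real \<Rightarrow> plane measure \<Rightarrow> real.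
        (\<forall>L \<in> dyadic. r L \<in> borel_measurable (P L) \<and> (\<forall>\<mu> \<in> space (P L). 1 \<le> r L \<mu>)) \<and>
        (SUP L \<in> dyadic. \<integral>\<^sup>+ \<mu>. ennreal (exp ((ln 2)\<^sup>2 / 54 * (r L \<mu>)\<^sup>2 / ln (2 * r L \<mu>))) \<partial>P L) < \<infinity> \<and>
        (\<forall>L \<in> dyadic. \<forall>\<mu> \<in> space (P L). \<forall>l \<in> dyadic. 2 * r L \<mu> \<le> l \<and> l \<le> L \<longrightarrow>
           W2_sq (restr \<mu> (Q l)) (uniform_on (measure \<mu> (Q l) / l\<^sup>2) (Q l)) / ennreal (l ^ 4)
             \<le> ennreal (ln (l / r L \<mu>) / (l / r L \<mu>)\<^sup>2))"
  proof (intro exI[of _ r] conjI ballI impI)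
    fix L :: real assume "L \<in> dyadic"
    then obtain K where L: "L = 2 ^ K" by (auto simp: dyadic_def)
    have "(\<lambda>\<mu>. M L \<mu>) \<in> borel_measurable (P L)"
      unfolding L M_pow by (rule worst_ratio_measurable[OF P_pow])
    then have "(\<lambda>\<mu>. \<psi> (M L \<mu> / (ln 2)\<^sup>2)) \<in> borel_measurable (P L)"
      by (intro measurable_compose[OF _ borel_measurable_mono[OF \<psi>(1)]] borel_measurable_divide) auto
    then show "r L \<in> borel_measurable (P L)" unfolding r_def by simp
    show "1 \<le> r L \<mu>" for \<mu> by (simp add: r_def \<psi>)
  next
    have "(\<integral>\<^sup>+ \<mu>. ennreal (exp ((ln 2)\<^sup>2 / 54 * (r L \<mu>)\<^sup>2 / ln (2 * r L \<mu>))) \<partial>P L) \<le> ennreal (3 * exp 2)"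
      if "L \<in> dyadic" for L
    proof -
      from that obtain K where L: "L = 2 ^ K" by (auto simp: dyadic_def)
      have eq: "(ln 2)\<^sup>2 / 54 * (r L \<mu>)\<^sup>2 / ln (2 * r L \<mu>) = M L \<mu> / 54" for \<mu>
        using r_eq[of L \<mu>] by (simp add: field_simps)
      show ?thesis
        unfolding eq unfolding L M_pow by (rule nn_integral_exp_worst_ratio_le[OF P_pow])
    qed
    then have "(SUP L \<in> dyadic. \<integral>\<^sup>+ \<mu>. ennreal (exp ((ln 2)\<^sup>2 / 54 * (r L \<mu>)\<^sup>2 / ln (2 * r L \<mu>))) \<partial>P L)
        \<le> ennreal (3 * exp 2)"
      by (intro SUP_least)
    then show "(SUP L \<in> dyadic. \<integral>\<^sup>+ \<mu>. ennreal (exp ((ln 2)\<^sup>2 / 54 * (r L \<mu>)\<^sup>2 / ln (2 * r L \<mu>))) \<partial>P L) < \<infinity>"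
      by (rule le_less_trans) simp
  next
    fix L \<mu> l assume "L \<in> dyadic" and \<mu>: "\<mu> \<in> space (P L)" and "l \<in> dyadic" and l_bounds: "2 * r L \<mu> \<le> l \<and> l \<le> L"
    then obtain K k where L: "L = 2 ^ K" and l: "l = 2 ^ k" by (auto simp: dyadic_def)
    have r1: "1 \<le> r L \<mu>" by (simp add: r_def \<psi>)
    \<comment> \<open>For k = 0 the side would be 1, less than 2 r.\<close>
    have "1 \<le> k" using l_bounds r1 unfolding l by (cases k) auto
    moreover have "k \<le> K" using l_bounds unfolding l L by simp
    ultimately have "cost_ratio \<mu> k / real k \<le> M L \<mu>"
      unfolding L M_pow by (rule ratio_le_worst_ratio)
    with \<open>1 \<le> k\<close> have "cost_ratio \<mu> k \<le> M L \<mu> * real k" by (simp add: divide_le_eq)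
    from ratio_le_ln_over_square[OF r1 r_eq this] l_bounds
    have ratio: "cost_ratio \<mu> k / 4 ^ k \<le> ln (l / r L \<mu>) / (l / r L \<mu>)\<^sup>2" by (simp add: l)
    have "\<mu> \<in> configurations (Q L)"
      using \<mu> unfolding L by (simp add: space_poisson_process_law[OF P_pow])
    from W2_sq_le_normalized_cost[OF this]
    have "W2_sq (restr \<mu> (Q l)) (uniform_on (measure \<mu> (Q l) / l\<^sup>2) (Q l)) / ennreal (l ^ 4)
        \<le> ennreal (4 ^ k * cost_ratio \<mu> k) / ennreal (l ^ 4)"
      unfolding l cost_ratio_def by (rule divide_right_mono_ennreal)
    also have "\<dots> = ennreal (cost_ratio \<mu> k / 4 ^ k)"
    proof -
      have "l ^ 4 = 4 ^ k * 4 ^ k"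
        unfolding l by (simp add: power_mult[symmetric] mult.commute[of k] flip: power_mult_distrib) (simp add: power_mult)
      then show ?thesis
        by (subst divide_ennreal) (auto simp: cost_ratio_def normalized_cost_nonneg)
    qed
    also have "\<dots> \<le> ennreal (ln (l / r L \<mu>) / (l / r L \<mu>)\<^sup>2)" by (intro ennreal_leI ratio)
    finally show "W2_sq (restr \<mu> (Q l)) (uniform_on (measure \<mu> (Q l) / l\<^sup>2) (Q l)) / ennreal (l ^ 4)
             \<le> ennreal (ln (l / r L \<mu>) / (l / r L \<mu>)\<^sup>2)" .
  qed
qed

end
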